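(* Let $K$ be a field and $X=\{x_1,\dots,x_n\}$ a finite connected poset with $n>1$. Every bijective strong commutativity and diagonality preserver $\varphi:I(X,K)\to I(X,K)$ is a composition $\varphi=S_\alpha\circ\tau_{\theta,\sigma,c,\kappa}$ of a commutativity preserver $S_\alpha$ of shift type and a pure commutativity preserver $\tau_{\theta,\sigma,c,\kappa}$, where $\theta:\mathcal{B}\to\mathcal{B}$ is a bijection monotone on maximal chains in $X$, $\sigma:X^2_<\to K^*$ is $c$-compatible with $\theta$, $c:X^2_<\to K^*$ is constant on maximal chains in $X$, the pair $(\theta,c)$ is admissible, and $\kappa=(k_1,\dots,k_n)\in K^n$ satisfies $\sum_{i=1}^n k_i\in K^*$.
   Context: Basic notation. $K^*=K\setminus\{0\}$. $I(X,K)$ is the incidence algebra: functions $f:X\times X\to K$ with $f(x,y)=0$ if $x\not\le y$, with product $(fg)(x,y)=\sum_{x\le z\le y}f(x,z)g(z,y)$ and identity $\delta$. $[f,g]=fg-gf$. For $x\le y$, $e_{xy}$ is the function equal to $1$ at $(x,y)$ and $0$ elsewhere; $e_x=e_{xx}$. $X^2_<=\{(x,y)\in X^2:x<y\}$, $\mathcal{B}=\{e_{xy}:x<y\}$, and $D(X,K)$ is the span of $\{e_x:x\in X\}$ (diagonal elements). The length of a finite chain $C$ is $|C|-1$, and $l(x,y)$ is the maximal length of chains in the interval $\{z:x\le z\le y\}$. A walk in $X$ is a sequence $u_0,\dots,u_m$ in which consecutive elements $u_i,u_{i+1}$ are comparable and the interval between them has length $1$; it is closed if $u_0=u_m$. $X$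 is connected if any two elements are joined by a walk. Preservers. A linear map $\varphi:I(X,K)\to I(X,K)$ is a commutativity preserver if $[a,b]=0$ implies $[\varphi(a),\varphi(b)]=0$; it is strong if the converse implication also holds; it is a diagonality preserver if $\varphi(D(X,K))\subseteq D(X,K)$. If $\varphi$ is a bijective strong commutativity and diagonality preserver, there are a unique bijection $\theta_\varphi:\mathcal{B}\to\mathcal{B}$ and maps $\sigma_\varphi:X^2_<\to K^*$, $\nu_\varphi:\mathcal{B}\to D(X,K)$ with $\varphi(e_{xy})=\sigma_\varphi(x,y)\theta_\varphi(e_{xy})+\nu_\varphi(e_{xy})$ for all $x<y$. Such a $\varphi$ is called a pure commutativity preserver if $\nu_\varphi(e_{xy})=0$ for all $x<y$. Shift type. For a linear map $\alpha:I(X,K)\to D(X,K)$ put $S_\alpha(f)=f+\alpha(f)$. A strong commutativity preserver of the form $S_\alpha$ is of shift type if: $[\alpha(e_{xy}),e_{uv}]=0$ for all $e_{xy}\ne e_{uv}$ in $\mathcal{B}$; $[\alpha(e_z),e_{xy}]=0$ for all $e_{xy}\in\mathcal{B}$ such that $z\notin\{x,y\}$ or $l(x,y)>1$; $[\alpha(e_x),e_{xy}]=[e_{xy},\alpha(e_y)]$ and $[\alpha(e_x),e_{xy}]\ne -e_{xy}$ for all $e_{xy}\in\mathcal{B}$ with $l(x,y)=1$. Properties of $\theta,\sigma,c$. A bijection $\theta:\mathcal{B}\to\mathcal{B}$ is increasing (resp. decreasing) on a maximal chain $u_1<\dots<u_m$ if there is a maximal chain $v_1<\dots<v_m$ in $X$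 with $\theta(e_{u_iu_j})=e_{v_iv_j}$ (resp. $\theta(e_{u_iu_j})=e_{v_{m-j+1}v_{m-i+1}}$) for all $1\le i<j\le m$; it is monotone on maximal chains in $X$ if on each maximal chain it is increasing or decreasing. Given $c:X^2_<\to K^*$, a map $\sigma:X^2_<\to K^*$ is $c$-compatible with $\theta$ if for all $x<y<z$: $\theta(e_{xz})=\theta(e_{xy})\theta(e_{yz})$ implies $c(x,z)\sigma(x,z)=\sigma(x,y)\sigma(y,z)$, and $\theta(e_{xz})=\theta(e_{yz})\theta(e_{xy})$ implies $c(x,z)\sigma(x,z)=-\sigma(x,y)\sigma(y,z)$. The map $c$ is constant on maximal chains if for every maximal chain $y_1<\dots<y_m$ in $X$ one has $c(y_i,y_j)=c(y_1,y_m)$ for all $1\le i<j\le m$. Admissibility. For a closed walk $\Gamma:u_0,u_1,\dots,u_m=u_0$ and $z\in X$ define: $s^+_{\theta,c,\Gamma}(z)=\sum c(z,w_i)$ over those $0\le i\le m-1$ with $u_i<u_{i+1}$ for which there is $w_i>z$ with $\theta(e_{zw_i})=e_{u_iu_{i+1}}$; $s^-_{\theta,c,\Gamma}(z)=\sum c(z,w_i)$ over those $i$ with $u_i>u_{i+1}$ for which there is $w_i>z$ with $\theta(e_{zw_i})=e_{u_{i+1}u_i}$; $t^+_{\theta,c,\Gamma}(z)=\sum c(w_i,z)$ over those $i$ with $u_i<u_{i+1}$ for which there is $w_i<z$ with $\theta(e_{w_iz})=e_{u_iu_{i+1}}$; $t^-_{\theta,c,\Gamma}(z)=\sum c(w_i,z)$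 over those $i$ with $u_i>u_{i+1}$ for which there is $w_i<z$ with $\theta(e_{w_iz})=e_{u_{i+1}u_i}$. The pair $(\theta,c)$ is admissible if $s^+_{\theta,c,\Gamma}(z)-s^-_{\theta,c,\Gamma}(z)=t^+_{\theta,c,\Gamma}(z)-t^-_{\theta,c,\Gamma}(z)$ for every closed walk $\Gamma$ and all $z\in X$. The map $\tau_{\theta,\sigma,c,\kappa}$. For $\theta,\sigma,c,\kappa$ with all the properties listed in the claim, $\tau=\tau_{\theta,\sigma,c,\kappa}$ is the linear map $I(X,K)\to I(X,K)$ given by $\tau(e_{xy})=\sigma(x,y)\theta(e_{xy})$ for $x<y$, $\tau(e_z)\in D(X,K)$ for all $z\in X$, $\tau(e_{x_i})(x_1,x_1)=k_i$ for $i=1,\dots,n$, and, for $z,v\in X$, $\tau(e_z)(v,v)=\tau(e_z)(x_1,x_1)+\sum_{i=0}^{m-1}\Delta_i(z)$, where $x_1=u_0,u_1,\dots,u_m=v$ is any walk, $v_i<w_i$ are such that $\theta(e_{v_iw_i})=e_{u_iu_{i+1}}$ if $u_i<u_{i+1}$ and $\theta(e_{v_iw_i})=e_{u_{i+1}u_i}$ if $u_i>u_{i+1}$, and $\Delta_i(z)=-c(v_i,w_i)$ if ($u_i<u_{i+1}$ and $z=v_i$) or ($u_i>u_{i+1}$ and $z=w_i$), $\Delta_i(z)=c(v_i,w_i)$ if ($u_i<u_{i+1}$ and $z=w_i$) or ($u_i>u_{i+1}$ and $z=v_i$), $\Delta_i(z)=0$ if $z\notin\{v_i,w_i\}$. (This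 does not depend on the choice of walks, by admissibility, and $\tau$ is a pure commutativity preserver.) *)

theory Defs
  imports Complex_Main
begin

section \<open>The incidence algebra of a finite poset\<close>

text \<open>The finite poset is the whole of a type of class \<open>order\<close> and \<open>finite\<close>.\<close>

typedef (overloaded) ('a :: "{finite,order}", 'k :: field) incidence =
  "{f :: 'a \<Rightarrow> 'a \<Rightarrow> 'k. \<forall>x y. \<not> x \<le> y \<longrightarrow> f x y = 0}"
  morphisms entry Abs_incidence
  by (rule exI[of _ "\<lambda>_ _. 0"]) simp

setup_lifting type_definition_incidence

lemma entry_eq_0: "\<not> x \<le> y \<Longrightarrow> entry f x y = 0"
  using entry[of f] by simp

lemma incidence_eqI: "(\<And>x y. entry f x y = entry g x y) \<Longrightarrow> f = g"
  by (simp add: entry_inject[symmetric] fun_eq_iff)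

instantiation incidence :: ("{finite,order}", field) ring_1
begin

lift_definition zero_incidence :: "('a, 'b) incidence" is "\<lambda>_ _. 0" by simp

lift_definition one_incidence :: "('a, 'b) incidence" is "\<lambda>x y. if x = y then 1 else 0" by auto

lift_definition plus_incidence :: "('a, 'b) incidence \<Rightarrow> ('a, 'b) incidence \<Rightarrow> ('a, 'b) incidence"
  is "\<lambda>f g x y. f x y + g x y" by simp

lift_definition minus_incidence :: "('a, 'b) incidence \<Rightarrow> ('a, 'b) incidence \<Rightarrow> ('a, 'b) incidence"
  is "\<lambda>f g x y. f x y - g x y" by simp

lift_definition uminus_incidence :: "('a, 'b) incidence \<Rightarrow> ('a, 'b) incidence"
  is "\<lambda>f x y. - f x y" by simp

lift_definition times_incidence :: "('a, 'b) incidence \<Rightarrow> ('a, 'b) incidence \<Rightarrow> ('a, 'b) incidence"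
  is "\<lambda>f g x y. \<Sum>z\<in>{x..y}. f x z * g z y" by simp

instance
proof
  fix f g h :: "('a, 'b) incidence"
  show "f + g + h = f + (g + h)" by transfer (simp add: add.assoc)
  show "f + g = g + f" by transfer (simp add: add.commute)
  show "0 + f = f" by transfer simp
  show "- f + f = 0" by transfer simp
  show "f - g = f + - g" by transfer simp
  show "(f + g) * h = f * h + g * h"
    by transfer (simp add: algebra_simps sum.distrib)
  show "f * (g + h) = f * g + f * h"
    by transfer (simp add: algebra_simps sum.distrib)
  show "(0 :: ('a, 'b) incidence) \<noteq> 1" by transfer (auto simp: fun_eq_iff)
  show "1 * f = f"
  proof (rule incidence_eqI)
    fix x y
    have "entry (1 * f) x y = (\<Sum>z\<in>{x..y}. if z = x then entry f x y else 0)"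
      unfolding times_incidence.rep_eq one_incidence.rep_eq by (rule sum.cong) auto
    then show "entry (1 * f) x y = entry f x y"
      by (auto simp: sum.delta entry_eq_0)
  qed
  show "f * 1 = f"
  proof (rule incidence_eqI)
    fix x y
    have "entry (f * 1) x y = (\<Sum>z\<in>{x..y}. if z = y then entry f x y else 0)"
      unfolding times_incidence.rep_eq one_incidence.rep_eq by (rule sum.cong) auto
    then show "entry (f * 1) x y = entry f x y"
      by (auto simp: sum.delta entry_eq_0)
  qed
  show "f * g * h = f * (g * h)"
  proof (rule incidence_eqI)
    have full: "entry (p * q) x y = (\<Sum>z\<in>UNIV. entry p x z * entry q z y)"
      for p q :: "('a, 'b) incidence" and x y
      unfolding times_incidence.rep_eq
      by (rule sum.mono_neutral_left) (auto simp: entry_eq_0)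
    fix x y
    have "entry (f * g * h) x y
        = (\<Sum>w\<in>UNIV. \<Sum>z\<in>UNIV. entry f x z * entry g z w * entry h w y)"
      by (simp add: full sum_distrib_right)
    also have "\<dots> = (\<Sum>z\<in>UNIV. \<Sum>w\<in>UNIV. entry f x z * entry g z w * entry h w y)"
      by (rule sum.swap)
    also have "\<dots> = entry (f * (g * h)) x y"
      by (simp add: full sum_distrib_left mult.assoc)
    finally show "entry (f * g * h) x y = entry (f * (g * h)) x y" .
  qed
qed

end

lift_definition scale ::
    "'k::field \<Rightarrow> ('a::{finite,order}, 'k) incidence \<Rightarrow> ('a, 'k) incidence"
  is "\<lambda>k f x y. k * f x y" by simp

interpretation incidence:
  vector_space "scale :: 'k::field \<Rightarrow> ('a::{finite,order}, 'k) incidence \<Rightarrow> ('a, 'k) incidence"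
  by unfold_locales (transfer; simp add: algebra_simps)+

text \<open>\<open>E x y\<close> is the element \<open>e\<^sub>x\<^sub>y\<close>; it is meaningful only for \<open>x \<le> y\<close> (and is \<open>0\<close> otherwise).\<close>

lift_definition E :: "'a::{finite,order} \<Rightarrow> 'a \<Rightarrow> ('a, 'k::field) incidence"
  is "\<lambda>x y u v. if x \<le> y \<and> u = x \<and> v = y then 1 else 0" by auto

definition commutator ::
    "('a::{finite,order}, 'k::field) incidence \<Rightarrow> ('a, 'k) incidence \<Rightarrow> ('a, 'k) incidence"
  where "commutator f g = f * g - g * f"

definition strict_units :: "('a::{finite,order}, 'k::field) incidence set"
  where "strict_units = {E x y | x y. x < y}"

definition diagonal :: "('a::{finite,order}, 'k::field) incidence set"
  where "diagonal = incidence.span (range (\<lambda>x. E x x))"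

section \<open>Chains and walks\<close>

definition interval_length :: "'a::{finite,order} \<Rightarrow> 'a \<Rightarrow> nat"
  where "interval_length x y =
    Max ((\<lambda>C. card C - 1) ` {C. C \<noteq> {} \<and> pred_on.chain {x..y} (<) C})"

text \<open>A chain \<open>u\<^sub>1 < \<dots> < u\<^sub>m\<close> is a strictly increasing list, with entries indexed from \<open>0\<close>.\<close>

definition maximal_chain :: "'a::{finite,order} list \<Rightarrow> bool"
  where "maximal_chain us \<longleftrightarrow> sorted_wrt (<) us \<and> pred_on.maxchain UNIV (<) (set us)"

text \<open>A walk \<open>u\<^sub>0, \<dots>, u\<^sub>m\<close> is a list of length \<open>m + 1\<close>.\<close>

definition walk :: "'a::{finite,order} list \<Rightarrow> bool"
  where "walk us \<longleftrightarrow> us \<noteq> [] \<and>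
    (\<forall>i < length us - 1.
       us ! i \<le> us ! (i + 1) \<and> interval_length (us ! i) (us ! (i + 1)) = 1 \<or>
       us ! (i + 1) \<le> us ! i \<and> interval_length (us ! (i + 1)) (us ! i) = 1)"

definition closed_walk :: "'a::{finite,order} list \<Rightarrow> bool"
  where "closed_walk us \<longleftrightarrow> walk us \<and> hd us = last us"

definition connected_poset :: "'a::{finite,order} itself \<Rightarrow> bool"
  where "connected_poset _ \<longleftrightarrow> (\<forall>x y :: 'a. \<exists>us. walk us \<and> hd us = x \<and> last us = y)"

section \<open>Commutativity preservers\<close>

abbreviation inc_linear ::
    "(('a::{finite,order}, 'k::field) incidence \<Rightarrow> ('a, 'k) incidence) \<Rightarrow> bool"
  where "inc_linear \<equiv> Vector_Spaces.linear scale scale"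

definition commutativity_preserver ::
    "(('a::{finite,order}, 'k::field) incidence \<Rightarrow> ('a, 'k) incidence) \<Rightarrow> bool"
  where "commutativity_preserver \<phi> \<longleftrightarrow> inc_linear \<phi> \<and>
    (\<forall>a b. commutator a b = 0 \<longrightarrow> commutator (\<phi> a) (\<phi> b) = 0)"

definition strong_commutativity_preserver ::
    "(('a::{finite,order}, 'k::field) incidence \<Rightarrow> ('a, 'k) incidence) \<Rightarrow> bool"
  where "strong_commutativity_preserver \<phi> \<longleftrightarrow> commutativity_preserver \<phi> \<and>
    (\<forall>a b. commutator (\<phi> a) (\<phi> b) = 0 \<longrightarrow> commutator a b = 0)"

definition diagonality_preserver ::
    "(('a::{finite,order}, 'k::field) incidence \<Rightarrow> ('a, 'k) incidence) \<Rightarrow> bool"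
  where "diagonality_preserver \<phi> \<longleftrightarrow> inc_linear \<phi> \<and> \<phi> ` diagonal \<subseteq> diagonal"

text \<open>Maps \<open>X\<^sup>2\<^sub>< \<rightarrow> K\<^sup>*\<close> are total functions whose values matter only on pairs \<open>x < y\<close>;
  likewise maps defined on the set \<open>strict_units\<close>.\<close>

definition nonzero_on_strict :: "('a::{finite,order} \<Rightarrow> 'a \<Rightarrow> 'k::field) \<Rightarrow> bool"
  where "nonzero_on_strict \<sigma> \<longleftrightarrow> (\<forall>x y. x < y \<longrightarrow> \<sigma> x y \<noteq> 0)"

definition preserver_data ::
    "(('a::{finite,order}, 'k::field) incidence \<Rightarrow> ('a, 'k) incidence) \<Rightarrow>
     (('a, 'k) incidence \<Rightarrow> ('a, 'k) incidence) \<Rightarrow> ('a \<Rightarrow> 'a \<Rightarrow> 'k) \<Rightarrow>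
     (('a, 'k) incidence \<Rightarrow> ('a, 'k) incidence) \<Rightarrow> bool"
  where "preserver_data \<phi> \<theta> \<sigma> \<nu> \<longleftrightarrow>
    bij_betw \<theta> strict_units strict_units \<and> nonzero_on_strict \<sigma> \<and>
    \<nu> ` strict_units \<subseteq> diagonal \<and>
    (\<forall>x y. x < y \<longrightarrow> \<phi> (E x y) = scale (\<sigma> x y) (\<theta> (E x y)) + \<nu> (E x y))"

text \<open>The data \<open>\<theta>, \<sigma>, \<nu>\<close> of a preserver are unique (on \<open>strict_units\<close> and strict pairs), so it
  makes no difference that they are quantified existentially here.\<close>

definition pure_commutativity_preserver ::
    "(('a::{finite,order}, 'k::field) incidence \<Rightarrow> ('a, 'k) incidence) \<Rightarrow> bool"
  where "pure_commutativity_preserver \<phi> \<longleftrightarrow>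
    bij \<phi> \<and> strong_commutativity_preserver \<phi> \<and> diagonality_preserver \<phi> \<and>
    (\<exists>\<theta> \<sigma> \<nu>. preserver_data \<phi> \<theta> \<sigma> \<nu> \<and> (\<forall>x y. x < y \<longrightarrow> \<nu> (E x y) = 0))"

definition shift ::
    "(('a::{finite,order}, 'k::field) incidence \<Rightarrow> ('a, 'k) incidence) \<Rightarrow>
     ('a, 'k) incidence \<Rightarrow> ('a, 'k) incidence"
  where "shift \<alpha> f = f + \<alpha> f"

text \<open>\<open>shift_type \<alpha>\<close> says that \<open>shift \<alpha>\<close> is a strong commutativity preserver of shift type.\<close>

definition shift_type ::
    "(('a::{finite,order}, 'k::field) incidence \<Rightarrow> ('a, 'k) incidence) \<Rightarrow> bool"
  where "shift_type \<alpha> \<longleftrightarrow>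
    inc_linear \<alpha> \<and> range \<alpha> \<subseteq> diagonal \<and> strong_commutativity_preserver (shift \<alpha>) \<and>
    (\<forall>a \<in> strict_units. \<forall>b \<in> strict_units. a \<noteq> b \<longrightarrow> commutator (\<alpha> a) b = 0) \<and>
    (\<forall>x y z. x < y \<longrightarrow> z \<notin> {x, y} \<or> interval_length x y > 1 \<longrightarrow>
       commutator (\<alpha> (E z z)) (E x y) = 0) \<and>
    (\<forall>x y. x < y \<longrightarrow> interval_length x y = 1 \<longrightarrow>
       commutator (\<alpha> (E x x)) (E x y) = commutator (E x y) (\<alpha> (E y y)) \<and>
       commutator (\<alpha> (E x x)) (E x y) \<noteq> - E x y)"

section \<open>Properties of \<open>\<theta>\<close>, \<open>\<sigma>\<close> and \<open>c\<close>\<close>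

definition increasing_on_chain ::
    "(('a::{finite,order}, 'k::field) incidence \<Rightarrow> ('a, 'k) incidence) \<Rightarrow> 'a list \<Rightarrow> bool"
  where "increasing_on_chain \<theta> us \<longleftrightarrow>
    (\<exists>vs. maximal_chain vs \<and> length vs = length us \<and>
       (\<forall>i j. i < j \<and> j < length us \<longrightarrow> \<theta> (E (us ! i) (us ! j)) = E (vs ! i) (vs ! j)))"

definition decreasing_on_chain ::
    "(('a::{finite,order}, 'k::field) incidence \<Rightarrow> ('a, 'k) incidence) \<Rightarrow> 'a list \<Rightarrow> bool"
  where "decreasing_on_chain \<theta> us \<longleftrightarrow>
    (\<exists>vs. maximal_chain vs \<and> length vs = length us \<and>
       (\<forall>i j. i < j \<and> j < length us \<longrightarrow>
          \<theta> (E (us ! i) (us ! j)) = E (vs ! (length us - 1 - j)) (vs ! (length us - 1 - i))))"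

definition monotone_on_maximal_chains ::
    "(('a::{finite,order}, 'k::field) incidence \<Rightarrow> ('a, 'k) incidence) \<Rightarrow> bool"
  where "monotone_on_maximal_chains \<theta> \<longleftrightarrow>
    (\<forall>us. maximal_chain us \<longrightarrow> increasing_on_chain \<theta> us \<or> decreasing_on_chain \<theta> us)"

definition compatible ::
    "('a::{finite,order} \<Rightarrow> 'a \<Rightarrow> 'k::field) \<Rightarrow> ('a \<Rightarrow> 'a \<Rightarrow> 'k) \<Rightarrow>
     (('a, 'k) incidence \<Rightarrow> ('a, 'k) incidence) \<Rightarrow> bool"
  where "compatible c \<sigma> \<theta> \<longleftrightarrow>
    (\<forall>x y z. x < y \<and> y < z \<longrightarrow>
       (\<theta> (E x z) = \<theta> (E x y) * \<theta> (E y z) \<longrightarrow> c x z * \<sigma> x z = \<sigma> x y * \<sigma> y z) \<and>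
       (\<theta> (E x z) = \<theta> (E y z) * \<theta> (E x y) \<longrightarrow> c x z * \<sigma> x z = - (\<sigma> x y * \<sigma> y z)))"

definition constant_on_maximal_chains :: "('a::{finite,order} \<Rightarrow> 'a \<Rightarrow> 'k::field) \<Rightarrow> bool"
  where "constant_on_maximal_chains c \<longleftrightarrow>
    (\<forall>ys. maximal_chain ys \<longrightarrow>
       (\<forall>i j. i < j \<and> j < length ys \<longrightarrow> c (ys ! i) (ys ! j) = c (hd ys) (last ys)))"

text \<open>In the next four sums the inner sum over \<open>w\<close> has at most one term when \<open>\<theta>\<close> is injective on
  \<open>strict_units\<close>: the term of the element \<open>w\<^sub>i\<close>, if that exists.\<close>

definition s_plus ::
    "(('a::{finite,order}, 'k::field) incidence \<Rightarrow> ('a, 'k) incidence) \<Rightarrow> ('a \<Rightarrow> 'a \<Rightarrow> 'k) \<Rightarrow>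
     'a list \<Rightarrow> 'a \<Rightarrow> 'k"
  where "s_plus \<theta> c us z =
    (\<Sum>i | i < length us - 1 \<and> us ! i < us ! (i + 1).
      \<Sum>w | z < w \<and> \<theta> (E z w) = E (us ! i) (us ! (i + 1)). c z w)"

definition s_minus ::
    "(('a::{finite,order}, 'k::field) incidence \<Rightarrow> ('a, 'k) incidence) \<Rightarrow> ('a \<Rightarrow> 'a \<Rightarrow> 'k) \<Rightarrow>
     'a list \<Rightarrow> 'a \<Rightarrow> 'k"
  where "s_minus \<theta> c us z =
    (\<Sum>i | i < length us - 1 \<and> us ! i > us ! (i + 1).
      \<Sum>w | z < w \<and> \<theta> (E z w) = E (us ! (i + 1)) (us ! i). c z w)"

definition t_plus ::
    "(('a::{finite,order}, 'k::field) incidence \<Rightarrow> ('a, 'k) incidence) \<Rightarrow> ('a \<Rightarrow> 'a \<Rightarrow> 'k) \<Rightarrow>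
     'a list \<Rightarrow> 'a \<Rightarrow> 'k"
  where "t_plus \<theta> c us z =
    (\<Sum>i | i < length us - 1 \<and> us ! i < us ! (i + 1).
      \<Sum>w | w < z \<and> \<theta> (E w z) = E (us ! i) (us ! (i + 1)). c w z)"

definition t_minus ::
    "(('a::{finite,order}, 'k::field) incidence \<Rightarrow> ('a, 'k) incidence) \<Rightarrow> ('a \<Rightarrow> 'a \<Rightarrow> 'k) \<Rightarrow>
     'a list \<Rightarrow> 'a \<Rightarrow> 'k"
  where "t_minus \<theta> c us z =
    (\<Sum>i | i < length us - 1 \<and> us ! i > us ! (i + 1).
      \<Sum>w | w < z \<and> \<theta> (E w z) = E (us ! (i + 1)) (us ! i). c w z)"

definition admissible_pair ::
    "(('a::{finite,order}, 'k::field) incidence \<Rightarrow> ('a, 'k) incidence) \<Rightarrow> ('a \<Rightarrow> 'a \<Rightarrow> 'k) \<Rightarrow> bool"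
  where "admissible_pair \<theta> c \<longleftrightarrow>
    (\<forall>us z. closed_walk us \<longrightarrow>
       s_plus \<theta> c us z - s_minus \<theta> c us z = t_plus \<theta> c us z - t_minus \<theta> c us z)"

section \<open>The maps \<open>\<tau>\<close>\<close>

text \<open>The contribution at \<open>z\<close> of a step from \<open>u\<close> to \<open>u'\<close> in a walk, where \<open>v < w\<close> is the pair with
  \<open>\<theta> (E v w) = E u u'\<close> or \<open>\<theta> (E v w) = E u' u\<close>.\<close>

definition step_delta ::
    "('a::{finite,order} \<Rightarrow> 'a \<Rightarrow> 'k::field) \<Rightarrow> 'a \<Rightarrow> 'a \<Rightarrow> 'a \<Rightarrow> 'a \<Rightarrow> 'a \<Rightarrow> 'k"
  where "step_delta c u u' v w z =
    (if u < u' \<and> z = v \<or> u > u' \<and> z = w then - c v w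
     else if u < u' \<and> z = w \<or> u > u' \<and> z = v then c v w
     else 0)"

text \<open>\<open>is_tau x n \<theta> \<sigma> c \<kappa> \<tau>\<close> says that \<open>\<tau> = \<tau>\<^bsub>\<theta>,\<sigma>,c,\<kappa>\<^esub>\<close> with respect to the enumeration
  \<open>x 1, \<dots>, x n\<close> of the poset. The formula for the diagonal entries is required for all walks; if
  the poset is connected and \<open>\<theta>\<close> is a bijection of \<open>strict_units\<close>, at most one \<open>\<tau>\<close> satisfies it.\<close>

definition is_tau ::
    "(nat \<Rightarrow> 'a::{finite,order}) \<Rightarrow> nat \<Rightarrow>
     (('a, 'k::field) incidence \<Rightarrow> ('a, 'k) incidence) \<Rightarrow> ('a \<Rightarrow> 'a \<Rightarrow> 'k) \<Rightarrow> ('a \<Rightarrow> 'a \<Rightarrow> 'k) \<Rightarrow>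
     (nat \<Rightarrow> 'k) \<Rightarrow> (('a, 'k) incidence \<Rightarrow> ('a, 'k) incidence) \<Rightarrow> bool"
  where "is_tau x n \<theta> \<sigma> c \<kappa> \<tau> \<longleftrightarrow>
    inc_linear \<tau> \<and>
    (\<forall>a b. a < b \<longrightarrow> \<tau> (E a b) = scale (\<sigma> a b) (\<theta> (E a b))) \<and>
    (\<forall>z. \<tau> (E z z) \<in> diagonal) \<and>
    (\<forall>i\<in>{1..n}. entry (\<tau> (E (x i) (x i))) (x 1) (x 1) = \<kappa> i) \<and>
    (\<forall>us vs ws z.
       walk us \<and> hd us = x 1 \<and>
       (\<forall>i < length us - 1. vs i < ws i \<and>
          (us ! i < us ! (i + 1) \<longrightarrow> \<theta> (E (vs i) (ws i)) = E (us ! i) (us ! (i + 1))) \<and>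
          (us ! i > us ! (i + 1) \<longrightarrow> \<theta> (E (vs i) (ws i)) = E (us ! (i + 1)) (us ! i))) \<longrightarrow>
       entry (\<tau> (E z z)) (last us) (last us) =
         entry (\<tau> (E z z)) (x 1) (x 1) +
         (\<Sum>i < length us - 1. step_delta c (us ! i) (us ! (i + 1)) (vs i) (ws i) z))"

end

theory Submission
  imports Defs
begin

text \<open>
  The diagonal subalgebra is its own centralizer, so \<open>\<phi>\<close> maps it onto itself. For \<open>x < y\<close> the diagonal
  elements commuting with \<open>E x y\<close> are those with \<open>d x x = d y y\<close>; since \<open>\<phi>\<close> maps this hyperplane to the
  diagonal centralizer of \<open>\<phi> (E x y)\<close>, the latter element is, up to a diagonal summand, a multiple of a
  single \<open>E u v\<close>. This defines \<open>\<theta>\<close>. Comparing two functionals with the same kernel yields \<open>c\<close> with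
  \<open>\<phi> d u u - \<phi> d v v = c x y * (d x x - d y y)\<close>, and summing this identity along walks gives both
  admissibility and the formula for the diagonal entries of \<open>\<tau>\<close>. The multiplicative properties of \<open>\<theta>\<close>,
  \<open>\<sigma>\<close>, \<open>c\<close> come from one commuting pair for each \<open>x < y < z\<close>. Finally, \<open>\<alpha>\<close> can be taken to vanish on
  diagonal elements: the map with \<open>\<alpha> \<circ> \<phi>\<close> sending each strict unit to the diagonal part of its image has
  \<open>[\<alpha> (E u v), E r s] = 0\<close> whenever \<open>E u v \<noteq> E r s\<close>, so \<open>shift \<alpha>\<close> preserves all commutators.
\<close>

section \<open>Entries of elements of the incidence algebra\<close>

lemma entry_zero [simp]: "entry 0 x y = 0"
  and entry_add [simp]: "entry (f + g) x y = entry f x y + entry g x y"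
  and entry_diff [simp]: "entry (f - g) x y = entry f x y - entry g x y"
  and entry_scale [simp]: "entry (scale k f) x y = k * entry f x y"
  and entry_one: "entry 1 x y = (if x = y then 1 else 0)"
  and entry_uminus [simp]: "entry (- f) x y = - entry f x y"
  and entry_E: "entry (E a b) x y = (if a \<le> b \<and> x = a \<and> y = b then 1 else 0)"
  by (transfer; simp)+

text \<open>Terms outside \<open>{x..y}\<close> vanish. Summing over the whole type lets later sums
  collapse to one term without interval side conditions.\<close>

lemma entry_mult: "entry (f * g) x y = (\<Sum>z\<in>UNIV. entry f x z * entry g z y)"
  unfolding times_incidence.rep_eq
  by (rule sum.mono_neutral_left) (auto simp: entry_eq_0)

lemma entry_sum: "entry (sum F A) x y = (\<Sum>i\<in>A. entry (F i) x y)"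
  by (induction A rule: infinite_finite_induct) auto

lemma scale_mult:
  "scale k f * g = scale k (f * g)" "f * scale k g = scale k (f * g)"
  by (rule incidence_eqI; simp add: entry_mult sum_distrib_left algebra_simps)+

lemma incidence_expand:
  fixes f :: "('a::{finite,order}, 'k::field) incidence"
  shows "f = (\<Sum>p\<in>UNIV. scale (entry f (fst p) (snd p)) (E (fst p) (snd p)))"
proof (rule incidence_eqI)
  fix x y
  have "(\<Sum>p\<in>UNIV. entry f (fst p) (snd p) * entry (E (fst p) (snd p)) x y)
      = (\<Sum>p\<in>UNIV. if p = (x, y) then entry f x y else 0)"
    by (rule sum.cong) (auto simp: entry_E entry_eq_0 split: if_splits)
  then show "entry f x y =
      entry (\<Sum>p\<in>UNIV. scale (entry f (fst p) (snd p)) (E (fst p) (snd p))) x y"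
    by (simp add: entry_sum)
qed

lemma E_eq_iff:
  assumes "x < y"
  shows "(E x y :: ('a::{finite,order}, 'k::field) incidence) = E u v \<longleftrightarrow> x = u \<and> y = v"
proof
  assume "(E x y :: ('a, 'k) incidence) = E u v"
  then have "entry (E x y :: ('a, 'k) incidence) x y = entry (E u v) x y" by simp
  then show "x = u \<and> y = v"
    using assms by (auto simp: entry_E split: if_splits)
qed simp

lemma E_nonzero: "x \<le> y \<Longrightarrow> E x y \<noteq> 0"
  by (metis entry_E entry_zero zero_neq_one)

lemma inc_linear_iff:
  fixes \<phi> :: "('a::{finite,order}, 'k::field) incidence \<Rightarrow> ('a, 'k) incidence"
  shows "inc_linear \<phi> \<longleftrightarrow>
    (\<forall>f g. \<phi> (f + g) = \<phi> f + \<phi> g) \<and> (\<forall>k f. \<phi> (scale k f) = scale k (\<phi> f))"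
  by (simp add: Vector_Spaces.linear_iff incidence.vector_space_axioms)

section \<open>Diagonal elements\<close>

lemma diagonal_iff:
  fixes f :: "('a::{finite,order}, 'k::field) incidence"
  shows "f \<in> diagonal \<longleftrightarrow> (\<forall>x y. x \<noteq> y \<longrightarrow> entry f x y = 0)"
proof
  assume "f \<in> diagonal"
  then show "\<forall>x y. x \<noteq> y \<longrightarrow> entry f x y = 0"
    unfolding diagonal_def
    by (induction rule: incidence.span_induct_alt) (auto simp: entry_E split: if_splits)
next
  assume off: "\<forall>x y. x \<noteq> y \<longrightarrow> entry f x y = 0"
  have "scale (entry f (fst p) (snd p)) (E (fst p) (snd p)) \<in> diagonal" for p :: "'a \<times> 'a"
  proof (cases "fst p = snd p")
    case True
    then show ?thesis
      unfolding diagonal_def by (simp add: incidence.span_scale incidence.span_base)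
  next
    case False
    then show ?thesis
      using off by (simp add: diagonal_def incidence.span_zero)
  qed
  then show "f \<in> diagonal"
    by (subst incidence_expand) (auto simp: diagonal_def intro: incidence.span_sum)
qed

lemma E_diagonal: "E z z \<in> diagonal"
  by (auto simp: diagonal_iff entry_E)

lemma one_diagonal: "1 \<in> diagonal"
  by (simp add: diagonal_iff entry_one)

lemma diagonal_add: "d \<in> diagonal \<Longrightarrow> d' \<in> diagonal \<Longrightarrow> d + d' \<in> diagonal"
  and diagonal_diff: "d \<in> diagonal \<Longrightarrow> d' \<in> diagonal \<Longrightarrow> d - d' \<in> diagonal"
  and diagonal_scale: "d \<in> diagonal \<Longrightarrow> scale k d \<in> diagonal"
  by (simp_all add: diagonal_iff)

lemma entry_diagonal_mult:
  assumes "d \<in> diagonal"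
  shows "entry (d * f) x y = entry d x x * entry f x y"
    and "entry (f * d) x y = entry f x y * entry d y y"
proof -
  have "(\<Sum>z\<in>UNIV. entry d x z * entry f z y)
      = (\<Sum>z\<in>UNIV. if z = x then entry d x x * entry f x y else 0)"
    using assms by (intro sum.cong) (auto simp: diagonal_iff)
  then show "entry (d * f) x y = entry d x x * entry f x y"
    by (simp add: entry_mult)
  have "(\<Sum>z\<in>UNIV. entry f x z * entry d z y)
      = (\<Sum>z\<in>UNIV. if z = y then entry f x y * entry d y y else 0)"
    using assms by (intro sum.cong) (auto simp: diagonal_iff)
  then show "entry (f * d) x y = entry f x y * entry d y y"
    by (simp add: entry_mult)
qed

lemma entry_commutator_diagonal:
  assumes "d \<in> diagonal"
  shows "entry (commutator d f) x y = (entry d x x - entry d y y) * entry f x y"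
    and "entry (commutator f d) x y = (entry d y y - entry d x x) * entry f x y"
  by (simp_all add: commutator_def entry_diagonal_mult[OF assms] algebra_simps)

lemma commutator_diagonal:
  assumes "d \<in> diagonal" "d' \<in> diagonal"
  shows "commutator d d' = 0"
  by (rule incidence_eqI)
    (use assms in \<open>simp add: entry_commutator_diagonal, force simp: diagonal_iff\<close>)

lemma commutator_diagonal_E_iff:
  assumes "d \<in> diagonal" "x < y"
  shows "commutator d (E x y) = 0 \<longleftrightarrow> entry d x x = entry d y y"
proof
  assume "commutator d (E x y) = 0"
  then have "entry (commutator d (E x y)) x y = 0" by simp
  then show "entry d x x = entry d y y"
    using assms by (simp add: entry_commutator_diagonal entry_E less_imp_le)
next
  assume "entry d x x = entry d y y"
  then show "commutator d (E x y) = 0"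
    by (intro incidence_eqI) (auto simp: entry_commutator_diagonal assms entry_E)
qed

text \<open>Commuting with the idempotent \<open>E x x\<close> alone already kills the off-diagonal
  entries of row \<open>x\<close>.\<close>

lemma centralizer_diagonal:
  fixes f :: "('a::{finite,order}, 'k::field) incidence"
  assumes "\<And>d. d \<in> diagonal \<Longrightarrow> commutator d f = 0"
  shows "f \<in> diagonal"
  unfolding diagonal_iff
proof (intro allI impI)
  fix x y :: 'a
  assume "x \<noteq> y"
  have "entry (commutator (E x x) f) x y = 0"
    using assms[OF E_diagonal] by simp
  then show "entry f x y = 0"
    using \<open>x \<noteq> y\<close> by (simp add: entry_commutator_diagonal E_diagonal entry_E)
qed

lemma E_mult:
  fixes a b c d :: "'a::{finite,order}"
  assumes "a \<le> b" "c \<le> d"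
  shows "(E a b * E c d :: ('a, 'k::field) incidence) = (if b = c then E a d else 0)"
proof (rule incidence_eqI)
  fix x y
  have "(\<Sum>z\<in>UNIV. entry (E a b) x z * entry (E c d) z y) =
      (\<Sum>z\<in>UNIV. if z = b then if x = a \<and> b = c \<and> y = d then 1 else 0 else (0::'k))"
    using assms by (intro sum.cong) (auto simp: entry_E)
  then show "entry (E a b * E c d) x y = entry (if b = c then E a d else 0 :: ('a, 'k) incidence) x y"
    using assms by (auto simp: entry_mult entry_E)
qed

text \<open>Images of strict units turn out to be a multiple of a unit plus a diagonal summand. This
  expansion is what \<open>R_commuting\<close> and \<open>R_triple\<close> evaluate at chosen
  positions; the two diagonal summands commute and leave no term.\<close>

lemma entry_commutator_normal_form:
  assumes "d \<in> diagonal" "d' \<in> diagonal"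
  shows "entry (commutator (scale s f + d) (g + d')) x y =
    s * entry (commutator f g) x y + (entry d x x - entry d y y) * entry g x y
      + s * (entry d' y y - entry d' x x) * entry f x y"
proof -
  have "commutator (scale s f + d) (g + d') =
      scale s (commutator f g) + scale s (commutator f d') + commutator d g + commutator d d'"
    by (simp add: commutator_def algebra_simps scale_mult)
  then show ?thesis
    by (simp add: entry_commutator_diagonal assms commutator_diagonal algebra_simps)
qed

section \<open>Diagonal parts, and shifts by diagonal-valued maps\<close>

lift_definition diagonal_part ::
    "('a::{finite,order}, 'k::field) incidence \<Rightarrow> ('a, 'k) incidence"
  is "\<lambda>f x y. if x = y then f x y else 0" by auto

lemma entry_diagonal_part [simp]:
  "entry (diagonal_part f) x y = (if x = y then entry f x y else 0)"
  by transfer simp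

lemma diagonal_part_diagonal: "diagonal_part f \<in> diagonal"
  by (simp add: diagonal_iff)

lemma diagonal_part_id: "d \<in> diagonal \<Longrightarrow> diagonal_part d = d"
  by (rule incidence_eqI) (simp add: diagonal_iff)

lemma diagonal_part_linear:
  "diagonal_part (f + g) = diagonal_part f + diagonal_part g"
  "diagonal_part (f - g) = diagonal_part f - diagonal_part g"
  "diagonal_part (scale k f) = scale k (diagonal_part f)"
  by (rule incidence_eqI; simp)+

text \<open>The two correction terms at \<open>(u, v)\<close> are both the product of the entries of
  \<open>f\<close> and \<open>g\<close> there with \<open>l u v\<close>, and they enter with
  opposite signs. It is essential that \<open>l\<close> does not depend on \<open>f\<close>.\<close>

lemma commutator_shift:
  assumes diag: "range \<alpha> \<subseteq> diagonal"
    and local: "\<And>f u v. u < v \<Longrightarrow>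
      entry (\<alpha> f) u u - entry (\<alpha> f) v v = entry f u v * l u v"
  shows "commutator (shift \<alpha> f) (shift \<alpha> g) = commutator f g"
proof (rule incidence_eqI)
  fix u v
  have d: "\<alpha> h \<in> diagonal" for h using diag by auto
  have "commutator (shift \<alpha> f) (shift \<alpha> g) =
      commutator f g + commutator f (\<alpha> g) + commutator (\<alpha> f) g + commutator (\<alpha> f) (\<alpha> g)"
    by (simp add: shift_def commutator_def algebra_simps)
  then have eq: "entry (commutator (shift \<alpha> f) (shift \<alpha> g)) u v =
      entry (commutator f g) u v +
      ((entry (\<alpha> f) u u - entry (\<alpha> f) v v) * entry g u v
        - (entry (\<alpha> g) u u - entry (\<alpha> g) v v) * entry f u v)"
    by (simp add: commutator_diagonal d entry_commutator_diagonal algebra_simps)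
  show "entry (commutator (shift \<alpha> f) (shift \<alpha> g)) u v = entry (commutator f g) u v"
  proof (cases "u < v")
    case True
    then show ?thesis unfolding eq by (simp add: local)
  next
    case False
    then show ?thesis unfolding eq
      by (cases "u = v") (auto simp: entry_eq_0 less_le)
  qed
qed

lemma walk_comparable:
  "walk us \<Longrightarrow> i < length us - 1 \<Longrightarrow> us ! i \<le> us ! (i + 1) \<or> us ! (i + 1) \<le> us ! i"
  by (auto simp: walk_def)

lemma walk_telescope:
  fixes F :: "'a::{finite,order} \<Rightarrow> 'k::field"
  assumes "walk us"
  shows "(\<Sum>i<length us - 1. F (us ! (i + 1)) - F (us ! i)) = F (last us) - F (hd us)"
  using assms sum_lessThan_telescope[of "\<lambda>i. F (us ! i)" "length us - 1"]
  by (simp add: walk_def hd_conv_nth last_conv_nth)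

section \<open>The bijection of strict pairs induced by a preserver\<close>

text \<open>The hypotheses pass to the inverse map (\<open>inverse_preserver\<close>), so every fact
  of this locale can also be instantiated at \<open>\<psi>\<close>; many arguments below are such
  dualizations.\<close>

locale comm_diag_preserver =
  fixes \<phi> :: "('a::{finite,order}, 'k::field) incidence \<Rightarrow> ('a, 'k) incidence"
  assumes bij: "bij \<phi>"
    and strong: "strong_commutativity_preserver \<phi>"
    and diagonality: "diagonality_preserver \<phi>"
begin

abbreviation \<psi> where "\<psi> \<equiv> inv \<phi>"

section \<open>The preserver and its inverse on the diagonal\<close>

lemma lin: "inc_linear \<phi>"
  using strong by (simp add: strong_commutativity_preserver_def commutativity_preserver_def)

lemma phi_linear:
  "\<phi> (f + g) = \<phi> f + \<phi> g" "\<phi> (f - g) = \<phi> f - \<phi> g" "\<phi> (scale k f) = scale k (\<phi> f)"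
proof -
  show add: "\<phi> (f + g) = \<phi> f + \<phi> g" and "\<phi> (scale k f) = scale k (\<phi> f)" for f g k
    using lin by (simp_all add: inc_linear_iff)
  show "\<phi> (f - g) = \<phi> f - \<phi> g"
    using add[of "f - g" g] by simp
qed

lemma phi_psi [simp]: "\<phi> (\<psi> f) = f" and psi_phi [simp]: "\<psi> (\<phi> f) = f"
  using bij by (simp_all add: bij_is_surj surj_f_inv_f bij_is_inj)

lemma commutator_phi_iff: "commutator (\<phi> a) (\<phi> b) = 0 \<longleftrightarrow> commutator a b = 0"
  using strong unfolding strong_commutativity_preserver_def commutativity_preserver_def by blast

lemma phi_diagonal: "d \<in> diagonal \<Longrightarrow> \<phi> d \<in> diagonal"
  using diagonality by (auto simp: diagonality_preserver_def)

text \<open>For diagonal \<open>d'\<close>, both \<open>\<phi> d'\<close> and \<open>d\<close> are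
  diagonal and commute; strongness pulls this back, and the diagonal is its own centralizer.\<close>

lemma psi_diagonal:
  assumes "d \<in> diagonal"
  shows "\<psi> d \<in> diagonal"
proof (rule centralizer_diagonal)
  fix d' :: "('a, 'k) incidence"
  assume "d' \<in> diagonal"
  then have "commutator (\<phi> d') (\<phi> (\<psi> d)) = 0"
    using assms by (simp add: commutator_diagonal phi_diagonal)
  then show "commutator d' (\<psi> d) = 0"
    by (simp only: commutator_phi_iff)
qed

lemma inverse_preserver: "comm_diag_preserver \<psi>"
proof
  show "bij \<psi>" by (rule bij_imp_bij_inv[OF bij])
  have "\<psi> (f + g) = \<psi> f + \<psi> g" for f g
    using psi_phi[of "\<psi> f + \<psi> g"] by (simp add: phi_linear)
  moreover have "\<psi> (scale k f) = scale k (\<psi> f)" for k f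
    using psi_phi[of "scale k (\<psi> f)"] by (simp add: phi_linear)
  ultimately have lin: "inc_linear \<psi>"
    by (simp add: inc_linear_iff)
  have "commutator (\<psi> a) (\<psi> b) = 0 \<longleftrightarrow> commutator a b = 0" for a b
    using commutator_phi_iff[of "\<psi> a" "\<psi> b"] by simp
  with lin show "strong_commutativity_preserver \<psi>"
    by (simp add: strong_commutativity_preserver_def commutativity_preserver_def)
  show "diagonality_preserver \<psi>"
    using lin psi_diagonal by (auto simp: diagonality_preserver_def)
qed

lemma inv_psi [simp]: "inv \<psi> = \<phi>"
  by (rule inv_inv_eq[OF bij])

text \<open>\<open>R x y u v\<close> stands for \<open>\<theta> (E x y) = E u v\<close>.\<close>

definition R :: "'a \<Rightarrow> 'a \<Rightarrow> 'a \<Rightarrow> 'a \<Rightarrow> bool"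
  where "R x y u v \<longleftrightarrow> x < y \<and> u < v \<and> entry (\<phi> (E x y)) u v \<noteq> 0"

text \<open>The diagonal elements commuting with \<open>\<phi> (E x y)\<close> form the image of a hyperplane, so only one
  strict pair can lie in the support of \<open>\<phi> (E x y)\<close>.\<close>

lemma phi_hyperplane:
  assumes "x < y" "d \<in> diagonal"
  shows "entry (\<psi> d) x x = entry (\<psi> d) y y \<longleftrightarrow> (\<forall>u v. R x y u v \<longrightarrow> entry d u u = entry d v v)"
proof -
  have "entry (\<psi> d) x x = entry (\<psi> d) y y \<longleftrightarrow> commutator (\<psi> d) (E x y) = 0"
    using assms by (simp add: commutator_diagonal_E_iff psi_diagonal)
  also have "\<dots> \<longleftrightarrow> commutator d (\<phi> (E x y)) = 0"
    using commutator_phi_iff[of "\<psi> d" "E x y"] by simp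
  also have "\<dots> \<longleftrightarrow> (\<forall>u v. (entry d u u - entry d v v) * entry (\<phi> (E x y)) u v = 0)"
    unfolding entry_commutator_diagonal(1)[OF assms(2), symmetric]
    by (auto intro: incidence_eqI)
  also have "\<dots> \<longleftrightarrow> (\<forall>u v. R x y u v \<longrightarrow> entry d u u = entry d v v)"
  proof -
    have "(entry d u u - entry d v v) * entry (\<phi> (E x y)) u v = 0 \<longleftrightarrow>
        (R x y u v \<longrightarrow> entry d u u = entry d v v)" for u v
      using assms(1) by (cases "u < v"; cases "u = v") (auto simp: R_def entry_eq_0 less_le)
    then show ?thesis by simp
  qed
  finally show ?thesis .
qed

text \<open>Without such a pair the right side of \<open>phi_hyperplane\<close> is vacuously true
  for every diagonal element, yet \<open>E x x\<close> has different entries at \<open>x\<close> and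
  \<open>y\<close>.\<close>

lemma R_exists:
  assumes "x < y"
  shows "\<exists>u v. R x y u v"
proof (rule ccontr)
  assume "\<nexists>u v. R x y u v"
  then have "entry (\<psi> (\<phi> (E x x))) x x = entry (\<psi> (\<phi> (E x x))) y y"
    by (subst phi_hyperplane[OF assms]) (auto simp: phi_diagonal E_diagonal)
  then show False using assms by (auto simp: entry_E split: if_splits)
qed

text \<open>The kernel of a single functional \<open>g\<close> on the diagonal cannot lie in both
  conditions "equal entries at \<open>u\<close>, \<open>v\<close>" and "equal entries at
  \<open>u'\<close>, \<open>v'\<close>" when the pairs differ.\<close>

lemma R_unique:
  assumes uv: "R x y u v" and uv': "R x y u' v'"
  shows "u' = u \<and> v' = v"
proof (rule ccontr)
  assume neq: "\<not> (u' = u \<and> v' = v)"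
  have "x < y" "u < v" "u' < v'" using assms by (auto simp: R_def)
  interpret inverse: comm_diag_preserver \<psi> by (rule inverse_preserver)
  define g where "g d = entry (\<psi> d) x x - entry (\<psi> d) y y" for d
  have g_linear: "g (d - d') = g d - g d'" "g (scale k d) = k * g d" for d d' k
    by (simp_all add: g_def inverse.phi_linear algebra_simps)
  have g0: "g d = 0 \<longleftrightarrow> (\<forall>u v. R x y u v \<longrightarrow> entry d u u = entry d v v)" if "d \<in> diagonal" for d
    using phi_hyperplane[OF \<open>x < y\<close> that] by (simp add: g_def)
  \<comment> \<open>The pairs are not swaps of each other, as both are increasing, so the second has
    an element outside the first.\<close>
  obtain a where a: "a \<in> {u', v'}" "a \<noteq> u" "a \<noteq> v"
    using neq \<open>u < v\<close> \<open>u' < v'\<close> by (metis insertI1 insertI2 less_asym less_irrefl)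
  have gE: "g (E b b) \<noteq> 0" if "R x y p q" "b \<in> {p, q}" for b p q
  proof
    assume "g (E b b) = 0"
    then have "entry (E b b :: ('a, 'k) incidence) p p = entry (E b b) q q"
      using that g0[OF E_diagonal] by blast
    then show False
      using that by (auto simp: R_def entry_E split: if_splits)
  qed
  have "g (E a a) \<noteq> 0"
    using gE[OF uv' a(1)] .
  \<comment> \<open>By linearity \<open>g d = 0\<close>, but the entries of \<open>d\<close> at
    \<open>u\<close> and \<open>v\<close> are \<open>g (E a a)\<close>, which is nonzero, and
    \<open>0\<close>.\<close>
  define d where "d = scale (g (E a a)) (E u u) - scale (g (E u u)) (E a a)"
  have "g d = 0" by (simp add: d_def g_linear)
  moreover have "d \<in> diagonal"
    by (simp add: d_def diagonal_diff diagonal_scale E_diagonal)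
  ultimately have "entry d u u = entry d v v"
    using g0[of d] uv by simp
  then show False
    using a(2,3) not_sym[OF less_imp_neq[OF \<open>u < v\<close>]] \<open>g (E a a) \<noteq> 0\<close>
    by (simp add: d_def entry_E)
qed

lemma phi_E:
  assumes "R x y u v"
  shows "\<phi> (E x y) = scale (entry (\<phi> (E x y)) u v) (E u v) + diagonal_part (\<phi> (E x y))"
proof (rule incidence_eqI)
  fix a b
  have "u < v" "x < y" using assms by (auto simp: R_def)
  have "entry (\<phi> (E x y)) a b = 0" if "\<not> (a = u \<and> b = v)" "a \<noteq> b"
  proof (rule ccontr)
    assume "entry (\<phi> (E x y)) a b \<noteq> 0"
    then have "R x y a b"
      unfolding R_def using \<open>x < y\<close> \<open>a \<noteq> b\<close> by (metis entry_eq_0 less_le)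
    then show False using R_unique[OF assms] that by blast
  qed
  then show "entry (\<phi> (E x y)) a b =
      entry (scale (entry (\<phi> (E x y)) u v) (E u v) + diagonal_part (\<phi> (E x y))) a b"
    using \<open>u < v\<close> by (auto simp: entry_E)
qed

lemma psi_E:
  assumes "R x y u v"
  defines "s \<equiv> entry (\<phi> (E x y)) u v"
  shows "\<psi> (E u v) = scale (1 / s) (E x y - \<psi> (diagonal_part (\<phi> (E x y))))"
proof -
  interpret inverse: comm_diag_preserver \<psi> by (rule inverse_preserver)
  have "s \<noteq> 0" using assms by (simp add: R_def)
  have "E x y = scale s (\<psi> (E u v)) + \<psi> (diagonal_part (\<phi> (E x y)))"
    using phi_E[OF assms(1)] psi_phi[of "E x y"]
    unfolding s_def by (metis inverse.phi_linear(1,3))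
  then have "E x y - \<psi> (diagonal_part (\<phi> (E x y))) = scale s (\<psi> (E u v))"
    by (metis add_diff_cancel_right')
  then show ?thesis
    using \<open>s \<noteq> 0\<close> by (simp add: incidence.scale_scale)
qed

lemma R_inverse_imp:
  assumes "R x y u v"
  shows "comm_diag_preserver.R \<psi> u v x y"
proof -
  interpret inverse: comm_diag_preserver \<psi> by (rule inverse_preserver)
  have "\<psi> (diagonal_part (\<phi> (E x y))) \<in> diagonal"
    by (simp add: psi_diagonal diagonal_part_diagonal)
  then show ?thesis
    using assms psi_E[OF assms] by (auto simp: inverse.R_def R_def entry_E diagonal_iff)
qed

text \<open>The converse is the forward direction for \<open>\<psi>\<close>, whose inverse is
  \<open>\<phi>\<close>. Injectivity and surjectivity of \<open>R\<close> thereby become uniqueness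
  and existence for \<open>\<psi>\<close>.\<close>

lemma R_inverse: "comm_diag_preserver.R \<psi> u v x y \<longleftrightarrow> R x y u v"
  using R_inverse_imp comm_diag_preserver.R_inverse_imp[OF inverse_preserver, unfolded inv_psi]
  by blast

lemma R_injective: "R x y u v \<Longrightarrow> R x' y' u v \<Longrightarrow> x' = x \<and> y' = y"
  using comm_diag_preserver.R_unique[OF inverse_preserver, unfolded R_inverse] .

lemma R_surjective: "u < v \<Longrightarrow> \<exists>x y. R x y u v"
  using comm_diag_preserver.R_exists[OF inverse_preserver, unfolded R_inverse] .

lemma R_less: "R x y u v \<Longrightarrow> x < y" "R x y u v \<Longrightarrow> u < v"
  by (simp_all add: R_def)

text \<open>The endpoint conditions make \<open>E x y\<close> and \<open>E p q\<close> commute,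
  hence also their images. Position \<open>(u, s)\<close>, respectively \<open>(r, v)\<close>, of
  that commutator isolates a product of the image units; once these are excluded,
  \<open>(r, s)\<close> isolates the diagonal part of \<open>\<phi> (E x y)\<close>.\<close>

lemma R_commuting:
  assumes uv: "R x y u v" and rs: "R p q r s" and neq: "\<not> (p = x \<and> q = y)"
    and "y \<noteq> p" "q \<noteq> x"
  shows "v \<noteq> r" and "s \<noteq> u"
    and "entry (\<phi> (E x y)) r r = entry (\<phi> (E x y)) s s"
proof -
  define d d' where "d = diagonal_part (\<phi> (E x y))" and "d' = diagonal_part (\<phi> (E p q))"
  define k k' where "k = entry (\<phi> (E x y)) u v" and "k' = entry (\<phi> (E p q)) r s"
  have diag: "d \<in> diagonal" "d' \<in> diagonal"
    by (simp_all add: d_def d'_def diagonal_part_diagonal)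
  have less: "x < y" "u < v" "p < q" "r < s" using uv rs by (auto dest: R_less)
  have "\<not> (r = u \<and> s = v)" using neq uv rs R_injective by blast
  have "k \<noteq> 0" "k' \<noteq> 0" using uv rs by (simp_all add: R_def k_def k'_def)
  have "commutator (E x y) (E p q) = (0 :: ('a, 'k) incidence)"
    using assms(4,5) less by (simp add: commutator_def E_mult less_imp_le)
  then have "commutator (scale k (E u v) + d) (scale k' (E r s) + d') = 0"
    using phi_E[OF uv] phi_E[OF rs] commutator_phi_iff[of "E x y" "E p q"]
    unfolding d_def d'_def k_def k'_def by simp
  then have eq: "k * entry (commutator (E u v) (scale k' (E r s))) a b
      + (entry d a a - entry d b b) * entry (scale k' (E r s)) a b
      + k * (entry d' b b - entry d' a a) * entry (E u v) a b = 0" for a b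
    using entry_commutator_normal_form[OF diag, of k "E u v" "scale k' (E r s)" a b] by simp
  have comm: "commutator (E u v) (scale k' (E r s)) =
      scale k' ((if v = r then E u s else 0) - (if s = u then E r v else 0))"
    using less by (simp add: commutator_def scale_mult E_mult less_imp_le
      incidence.scale_right_diff_distrib)
  show "v \<noteq> r"
    using eq[of u s] less \<open>k \<noteq> 0\<close> \<open>k' \<noteq> 0\<close>
    by (auto simp: comm entry_E split: if_splits)
  show "s \<noteq> u"
    using eq[of r v] less \<open>k \<noteq> 0\<close> \<open>k' \<noteq> 0\<close>
    by (auto simp: comm entry_E split: if_splits)
  show "entry (\<phi> (E x y)) r r = entry (\<phi> (E x y)) s s"
    using eq[of r s] less \<open>k \<noteq> 0\<close> \<open>k' \<noteq> 0\<close> \<open>\<not> (r = u \<and> s = v)\<close>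
    by (auto simp: comm entry_E d_def split: if_splits)
qed

text \<open>For \<open>x < y < z\<close> the elements \<open>E x x + E x y\<close> and \<open>E y z - E x z\<close> commute; the statement
  results from comparing entries in the commutator of their images.\<close>

lemma R_triple:
  assumes ab: "R x y a b" and pq: "R y z p q" and rs: "R x z r s"
  defines "k \<equiv> (entry (\<phi> (E x x)) r r - entry (\<phi> (E x x)) s s) * entry (\<phi> (E x z)) r s"
    and "l \<equiv> entry (\<phi> (E x y)) a b * entry (\<phi> (E y z)) p q"
  shows "b = p \<and> r = a \<and> s = q \<and> k = l \<or> q = a \<and> r = p \<and> s = b \<and> k = - l" (is ?composite)
    and "entry (\<phi> (E x y)) p p = entry (\<phi> (E x y)) q q"
    and "entry (\<phi> (E y z)) a a = entry (\<phi> (E y z)) b b"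
proof -
  define d\<^sub>1 d\<^sub>2 d\<^sub>3 where "d\<^sub>1 = diagonal_part (\<phi> (E x y))"
    and "d\<^sub>2 = diagonal_part (\<phi> (E y z))" and "d\<^sub>3 = diagonal_part (\<phi> (E x z))"
  define s\<^sub>1 s\<^sub>2 s\<^sub>3 where "s\<^sub>1 = entry (\<phi> (E x y)) a b"
    and "s\<^sub>2 = entry (\<phi> (E y z)) p q" and "s\<^sub>3 = entry (\<phi> (E x z)) r s"
  have less: "x < y" "y < z" "x < z" "a < b" "p < q" "r < s"
    using ab pq rs by (auto dest: R_less)
  have nz: "s\<^sub>1 \<noteq> 0" "s\<^sub>2 \<noteq> 0" "s\<^sub>3 \<noteq> 0"
    using ab pq rs by (simp_all add: R_def s\<^sub>1_def s\<^sub>2_def s\<^sub>3_def)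
  have d: "\<phi> (E x x) + d\<^sub>1 \<in> diagonal" "d\<^sub>2 - d\<^sub>3 \<in> diagonal"
    by (simp_all add: diagonal_add diagonal_diff phi_diagonal E_diagonal diagonal_part_diagonal
        d\<^sub>1_def d\<^sub>2_def d\<^sub>3_def)
  have d13: "b \<noteq> r" "s \<noteq> a" "entry d\<^sub>1 r r = entry d\<^sub>1 s s"
    using R_commuting[OF ab rs] less by (auto simp: d\<^sub>1_def)
  have d31: "entry d\<^sub>3 a a = entry d\<^sub>3 b b"
    using R_commuting(3)[OF rs ab] less by (auto simp: d\<^sub>3_def)
  have distinct: "\<not> (p = a \<and> q = b)" "\<not> (r = a \<and> s = b)" "\<not> (r = p \<and> s = q)"
    using R_injective ab pq rs less by blast+
  \<comment> \<open>If the image units were not composable, \<open>R_commuting\<close> for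
    \<open>\<psi>\<close> would say that \<open>E x y\<close> and \<open>E y z\<close> are not
    composable, that is, \<open>y \<noteq> y\<close>.\<close>
  have bp: "b = p \<or> q = a"
    using comm_diag_preserver.R_commuting(1)[OF inverse_preserver, unfolded R_inverse, OF ab pq]
      distinct by blast
  \<comment> \<open>\<open>E x x\<close> has entry 0 at both \<open>y\<close> and
    \<open>z\<close>.\<close>
  have e_x: "entry (\<phi> (E x x)) p p = entry (\<phi> (E x x)) q q"
    using phi_hyperplane[of y z "\<phi> (E x x)"] pq less
    by (auto simp: phi_diagonal E_diagonal entry_E split: if_splits)
  have "commutator (E x y + E x x) (E y z - E x z) = (0 :: ('a, 'k) incidence)"
    using less by (auto simp: commutator_def algebra_simps E_mult less_imp_le)
  then have "commutator (\<phi> (E x y) + \<phi> (E x x)) (\<phi> (E y z) - \<phi> (E x z)) = 0"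
    by (simp add: commutator_phi_iff flip: phi_linear)
  moreover have "\<phi> (E x y) + \<phi> (E x x) = scale s\<^sub>1 (E a b) + (\<phi> (E x x) + d\<^sub>1)"
    using phi_E[OF ab] by (simp add: s\<^sub>1_def d\<^sub>1_def)
  moreover have "\<phi> (E y z) - \<phi> (E x z) =
      (scale s\<^sub>2 (E p q) - scale s\<^sub>3 (E r s)) + (d\<^sub>2 - d\<^sub>3)"
    using phi_E[OF pq] phi_E[OF rs]
    unfolding s\<^sub>2_def d\<^sub>2_def s\<^sub>3_def d\<^sub>3_def by (simp add: algebra_simps)
  ultimately have "commutator (scale s\<^sub>1 (E a b) + (\<phi> (E x x) + d\<^sub>1))
      ((scale s\<^sub>2 (E p q) - scale s\<^sub>3 (E r s)) + (d\<^sub>2 - d\<^sub>3)) = 0"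
    by simp
  \<comment> \<open>By \<open>d13\<close> the unit \<open>E r s\<close> composes with
    \<open>E a b\<close> on neither side, so only the products with \<open>E p q\<close>
    survive.\<close>
  moreover have "commutator (E a b) (scale s\<^sub>2 (E p q) - scale s\<^sub>3 (E r s)) =
      scale s\<^sub>2 ((if b = p then E a q else 0) - (if q = a then E p b else 0))"
    using less d13 by (simp add: commutator_def scale_mult E_mult less_imp_le algebra_simps
        incidence.scale_right_diff_distrib)
  ultimately have eq:
    "s\<^sub>1 * (s\<^sub>2 * entry ((if b = p then E a q else 0) - (if q = a then E p b else 0)) i j)
      + (entry (\<phi> (E x x)) i i + entry d\<^sub>1 i i - (entry (\<phi> (E x x)) j j + entry d\<^sub>1 j j))
        * (s\<^sub>2 * entry (E p q) i j - s\<^sub>3 * entry (E r s) i j)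
      + s\<^sub>1 * ((entry d\<^sub>2 j j - entry d\<^sub>3 j j) - (entry d\<^sub>2 i i - entry d\<^sub>3 i i)) * entry (E a b) i j = 0"
    for i j
    using entry_commutator_normal_form[OF d, of s\<^sub>1 "E a b"
        "scale s\<^sub>2 (E p q) - scale s\<^sub>3 (E r s)" i j] by simp
  \<comment> \<open>The surviving product sits at \<open>(a, q)\<close> or \<open>(p, b)\<close>
    with a nonzero coefficient. Only the \<open>E r s\<close> term can cancel it, which forces the
    position of \<open>E r s\<close> and the value of \<open>k\<close>.\<close>
  show ?composite
    using bp
  proof
    assume "b = p"
    then show ?composite
      using eq[of a q] less nz d13(3)
      by (auto simp: entry_E k_def l_def s\<^sub>1_def s\<^sub>2_def s\<^sub>3_def algebra_simps split: if_splits)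
  next
    assume "q = a"
    then show ?composite
      using eq[of p b] less nz d13(3)
      by (auto simp: entry_E k_def l_def s\<^sub>1_def s\<^sub>2_def s\<^sub>3_def algebra_simps split: if_splits)
  qed
  show "entry (\<phi> (E x y)) p p = entry (\<phi> (E x y)) q q"
    using eq[of p q] less nz distinct e_x
    by (auto simp: entry_E d\<^sub>1_def split: if_splits)
  show "entry (\<phi> (E y z)) a a = entry (\<phi> (E y z)) b b"
    using eq[of a b] less nz distinct d31
    by (auto simp: entry_E d\<^sub>2_def split: if_splits)
qed

text \<open>Let \<open>E p q\<close> be the preimage unit of \<open>E r s\<close>. If it commutes
  with \<open>E x y\<close>, \<open>R_commuting\<close> applies; otherwise the two form a chain of
  three elements, in one order or the other, and \<open>R_triple\<close> applies. This locality is
  what makes \<open>alpha\<close> of shift type.\<close>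

lemma phi_E_diagonal_entries:
  assumes uv: "R x y u v" and "r < s" and neq: "\<not> (r = u \<and> s = v)"
  shows "entry (\<phi> (E x y)) r r = entry (\<phi> (E x y)) s s"
proof -
  obtain p q where rs: "R p q r s"
    using R_surjective[OF \<open>r < s\<close>] by blast
  have pq: "\<not> (p = x \<and> q = y)"
    using R_unique uv rs neq by blast
  have less: "x < y" "p < q" using uv rs by (auto dest: R_less)
  consider "y \<noteq> p" "q \<noteq> x" | "y = p" | "q = x" by blast
  then show ?thesis
  proof cases
    case 1
    then show ?thesis using R_commuting(3)[OF uv rs pq] by blast
  next
    case 2
    then have "x < q" using less by simp
    then show ?thesis using R_triple(2)[OF uv] rs R_exists 2 by blast
  next
    case 3
    then have "p < y" using less by simp
    then show ?thesis using R_triple(3)[OF rs] uv R_exists 3 by blast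
  qed
qed

section \<open>Images of chains\<close>

text \<open>Two of the pairs assigned to \<open>(m, i)\<close>, for \<open>m\<close> the least element of the chain, agree in the first
  or in the second component, by \<open>R_triple\<close>; hence all of them agree in the same component.\<close>

lemma chain_image:
  assumes chain: "pred_on.chain UNIV (<) C"
  shows "\<exists>p. (\<forall>x\<in>C. \<forall>y\<in>C. x < y \<longrightarrow> R x y (p x) (p y)) \<or>
    (\<forall>x\<in>C. \<forall>y\<in>C. x < y \<longrightarrow> R x y (p y) (p x))"
proof (cases "C = {}")
  case False
  obtain m where "m \<in> C" and min: "\<And>x. x \<in> C \<Longrightarrow> \<not> x < m"
    using finite_has_minimal[OF finite False] by (metis less_le)
  define S where "S = C - {m}"
  have m_less: "m < x" if "x \<in> S" for x
    using chain \<open>m \<in> C\<close> min that by (auto simp: S_def pred_on.chain_def)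
  obtain f g where fg: "\<And>x. x \<in> S \<Longrightarrow> R m x (f x) (g x)"
    using R_exists m_less by metis
  \<comment> \<open>By \<open>R_triple\<close> for \<open>m < x < y\<close>, the image of
    \<open>(m, y)\<close> is composed of those of \<open>(m, x)\<close> and \<open>(x, y)\<close> in
    one of two orders.\<close>
  have R_pair: "R x y (g x) (g y) \<and> f y = f x \<or> R x y (f y) (f x) \<and> g y = g x"
    if "x \<in> S" "y \<in> S" "x < y" for x y
  proof -
    obtain r s where rs: "R x y r s" using R_exists \<open>x < y\<close> by blast
    then show ?thesis
      using R_triple(1)[OF fg[OF \<open>x \<in> S\<close>] rs fg[OF \<open>y \<in> S\<close>]] by auto
  qed
  have same: "f x = f y \<or> g x = g y" if "x \<in> S" "y \<in> S" for x y
    using that R_pair[of x y] R_pair[of y x] chain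
    by (cases "x < y"; cases "y < x") (auto simp: S_def pred_on.chain_def)
  \<comment> \<open>If two equivalence relations together relate all pairs, one of them already
    does.\<close>
  have "(\<forall>x\<in>S. \<forall>y\<in>S. f x = f y) \<or> (\<forall>x\<in>S. \<forall>y\<in>S. g x = g y)"
    using same by metis
  then show ?thesis
  proof
    assume f: "\<forall>x\<in>S. \<forall>y\<in>S. f x = f y"
    \<comment> \<open>\<open>m\<close> goes to the shared component, every other element to its own
      second component; \<open>SOME\<close> merely names a member of \<open>S\<close>.\<close>
    define p where "p x = (if x = m then f (SOME y. y \<in> S) else g x)" for x
    have "R x y (p x) (p y)" if "x \<in> C" "y \<in> C" "x < y" for x y
    proof -
      have "y \<in> S" using that min by (auto simp: S_def)
      show ?thesis
      proof (cases "x = m")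
        case True
        have "f (SOME y. y \<in> S) = f y"
          using f \<open>y \<in> S\<close> someI[of "\<lambda>y. y \<in> S"] by blast
        then show ?thesis
          using True fg[OF \<open>y \<in> S\<close>] \<open>x < y\<close> by (auto simp: p_def)
      next
        case False
        then have "x \<in> S" using that by (simp add: S_def)
        \<comment> \<open>Otherwise \<open>(m, x)\<close> and \<open>(m, y)\<close> would have the
          same image. This rules out the order-reversing alternative of
          \<open>R_pair\<close>.\<close>
        moreover have "g y \<noteq> g x"
          using f R_injective[of m x "f x" "g x" m y] fg \<open>x \<in> S\<close> \<open>y \<in> S\<close> \<open>x < y\<close>
          by (metis less_irrefl)
        ultimately show ?thesis
          using R_pair \<open>y \<in> S\<close> \<open>x < y\<close> False m_less by (auto simp: p_def)
      qed
    qed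
    then show ?thesis by blast
  next
    assume g: "\<forall>x\<in>S. \<forall>y\<in>S. g x = g y"
    define p where "p x = (if x = m then g (SOME y. y \<in> S) else f x)" for x
    have "R x y (p y) (p x)" if "x \<in> C" "y \<in> C" "x < y" for x y
    proof -
      have "y \<in> S" using that min by (auto simp: S_def)
      show ?thesis
      proof (cases "x = m")
        case True
        have "g (SOME y. y \<in> S) = g y"
          using g \<open>y \<in> S\<close> someI[of "\<lambda>y. y \<in> S"] by blast
        then show ?thesis
          using True fg[OF \<open>y \<in> S\<close>] \<open>x < y\<close> by (auto simp: p_def)
      next
        case False
        then have "x \<in> S" using that by (simp add: S_def)
        moreover have "f y \<noteq> f x"
          using g R_injective[of m x "f x" "g x" m y] fg \<open>x \<in> S\<close> \<open>y \<in> S\<close> \<open>x < y\<close>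
          by (metis less_irrefl)
        ultimately show ?thesis
          using R_pair \<open>y \<in> S\<close> \<open>x < y\<close> False m_less by (auto simp: p_def)
      qed
    qed
    then show ?thesis by blast
  qed
qed simp

lemma chain_image_inj:
  assumes chain: "pred_on.chain UNIV (<) C"
    and p: "(\<forall>x\<in>C. \<forall>y\<in>C. x < y \<longrightarrow> R x y (p x) (p y)) \<or>
      (\<forall>x\<in>C. \<forall>y\<in>C. x < y \<longrightarrow> R x y (p y) (p x))"
  shows "inj_on p C" and "pred_on.chain UNIV (<) (p ` C)"
proof -
  have comparable: "p x < p y \<or> p y < p x" if "x \<in> C" "y \<in> C" "x \<noteq> y" for x y
  proof -
    have "x < y \<or> y < x"
      using chain that by (auto simp: pred_on.chain_def)
    then show ?thesis using p that by (meson R_less(2))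
  qed
  then show "inj_on p C"
    by (metis inj_onI less_irrefl)
  show "pred_on.chain UNIV (<) (p ` C)"
    using comparable by (fastforce simp: pred_on.chain_def)
qed

text \<open>A chain properly containing the image is carried back by \<open>chain_image\<close> for
  \<open>\<psi>\<close> to a chain properly containing \<open>C\<close>. Two distinct elements are
  required because \<open>R\<close> relates pairs only and leaves \<open>p\<close> free on a
  singleton.\<close>

lemma maxchain_image:
  assumes max: "pred_on.maxchain UNIV (<) C" and "x \<in> C" "y \<in> C" "x \<noteq> y"
    and p: "(\<forall>x\<in>C. \<forall>y\<in>C. x < y \<longrightarrow> R x y (p x) (p y)) \<or>
      (\<forall>x\<in>C. \<forall>y\<in>C. x < y \<longrightarrow> R x y (p y) (p x))"
  shows "pred_on.maxchain UNIV (<) (p ` C)"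
proof -
  interpret inverse: comm_diag_preserver \<psi> by (rule inverse_preserver)
  have chain: "pred_on.chain UNIV (<) C"
    using max by (simp add: pred_on.maxchain_def)
  have "\<not> p ` C \<subset> B" if B: "pred_on.chain UNIV (<) B" for B
  proof
    assume "p ` C \<subset> B"
    obtain q where q: "(\<forall>x\<in>B. \<forall>y\<in>B. x < y \<longrightarrow> R (q x) (q y) x y) \<or>
        (\<forall>x\<in>B. \<forall>y\<in>B. x < y \<longrightarrow> R (q y) (q x) x y)"
      using inverse.chain_image[OF B] unfolding R_inverse by blast
    have q_chain: "pred_on.chain UNIV (<) (q ` B)" and "inj_on q B"
      using inverse.chain_image_inj[OF B, unfolded R_inverse, OF q] by auto
    \<comment> \<open>\<open>q\<close> may reverse the order, so injectivity of \<open>R\<close>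
      recovers \<open>u\<close> and \<open>v\<close> only as an unordered pair, which suffices
      here.\<close>
    have in_image: "u \<in> q ` B \<and> v \<in> q ` B" if uv: "u \<in> C" "v \<in> C" "u < v" for u v
    proof -
      have "p u \<in> B" "p v \<in> B" using uv \<open>p ` C \<subset> B\<close> by auto
      obtain w w' where w: "R u v w w'" "w \<in> B" "w' \<in> B"
        using p uv \<open>p u \<in> B\<close> \<open>p v \<in> B\<close> by blast
      then have "R (q w) (q w') w w' \<or> R (q w') (q w) w w'"
        using q R_less(2) by blast
      then have "u \<in> {q w, q w'} \<and> v \<in> {q w, q w'}"
        using R_injective[OF w(1)] by blast
      then show ?thesis using w by blast
    qed
    have "C \<subseteq> q ` B"
    proof
      fix u assume "u \<in> C"
      obtain v where "v \<in> C" "u \<noteq> v" using assms(2-4) by metis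
      then have "u < v \<or> v < u"
        using chain \<open>u \<in> C\<close> by (auto simp: pred_on.chain_def)
      then show "u \<in> q ` B" using in_image \<open>u \<in> C\<close> \<open>v \<in> C\<close> by blast
    qed
    moreover have "card C < card (q ` B)"
    proof -
      have "card C = card (p ` C)"
        using chain_image_inj(1)[OF chain p] by (simp add: card_image)
      also have "\<dots> < card B" using \<open>p ` C \<subset> B\<close> by (simp add: psubset_card_mono)
      also have "\<dots> = card (q ` B)" using \<open>inj_on q B\<close> by (simp add: card_image)
      finally show ?thesis .
    qed
    ultimately have "C \<subset> q ` B" by auto
    then show False using max q_chain by (auto simp: pred_on.maxchain_def)
  qed
  then show ?thesis
    using chain_image_inj(2)[OF chain p] by (auto simp: pred_on.maxchain_def)
qed

section \<open>The data of the factorization\<close>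

text \<open>The argument is an algebra element, from which the pair \<open>(x, y)\<close> has to be
  recovered; outside \<open>strict_units\<close> the value is unspecified.\<close>

definition theta :: "('a, 'k) incidence \<Rightarrow> ('a, 'k) incidence"
  where "theta a = (THE b. \<exists>x y u v. R x y u v \<and> a = E x y \<and> b = E u v)"

definition sigma :: "'a \<Rightarrow> 'a \<Rightarrow> 'k"
  where "sigma x y = (THE s. \<exists>u v. R x y u v \<and> s = entry (\<phi> (E x y)) u v)"

text \<open>\<open>ratio\<close> is the map \<open>c\<close>.\<close>

definition ratio :: "'a \<Rightarrow> 'a \<Rightarrow> 'k"
  where "ratio x y =
    (THE s. \<exists>u v. R x y u v \<and> s = entry (\<phi> (E x x)) u u - entry (\<phi> (E x x)) v v)"

lemma theta_E:
  assumes "R x y u v"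
  shows "theta (E x y) = E u v"
  unfolding theta_def
proof (rule the_equality)
  fix b :: "('a, 'k) incidence"
  assume "\<exists>x' y' u' v'. R x' y' u' v' \<and> E x y = (E x' y' :: ('a, 'k) incidence) \<and> b = E u' v'"
  then obtain x' y' u' v' where R: "R x' y' u' v'" and b: "b = E u' v'"
    and "E x y = (E x' y' :: ('a, 'k) incidence)" by blast
  then have "x' = x" "y' = y"
    using E_eq_iff[OF R_less(1)[OF assms], of x' y'] by auto
  then show "b = E u v" using R_unique[OF assms] R b by blast
qed (use assms in blast)

lemma sigma_eq: "R x y u v \<Longrightarrow> sigma x y = entry (\<phi> (E x y)) u v"
  unfolding sigma_def by (rule the_equality) (auto dest: R_unique)

lemma ratio_eq:
  "R x y u v \<Longrightarrow> ratio x y = entry (\<phi> (E x x)) u u - entry (\<phi> (E x x)) v v"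
  unfolding ratio_def by (rule the_equality) (auto dest: R_unique)

lemma theta_E_iff:
  assumes "x < y" "u < v"
  shows "theta (E x y) = E u v \<longleftrightarrow> R x y u v"
proof
  obtain u' v' where R: "R x y u' v'" using R_exists[OF assms(1)] by blast
  assume "theta (E x y) = E u v"
  then have "E u v = (E u' v' :: ('a, 'k) incidence)" using theta_E[OF R] by simp
  then show "R x y u v" using R assms(2) by (simp add: E_eq_iff)
qed (rule theta_E)

lemma bij_betw_theta: "bij_betw theta strict_units strict_units"
proof (rule bij_betw_imageI)
  show "inj_on theta strict_units"
  proof (rule inj_onI)
    fix a b :: "('a, 'k) incidence"
    assume "a \<in> strict_units" "b \<in> strict_units" "theta a = theta b"
    then obtain x y x' y' where xy: "a = E x y" "b = E x' y'" "x < y" "x' < y'"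
      by (auto simp: strict_units_def)
    obtain u v where "R x y u v" using R_exists[OF \<open>x < y\<close>] by blast
    then have "R x' y' u v"
      using \<open>theta a = theta b\<close> xy theta_E theta_E_iff[of x' y' u v] R_less(2) by metis
    then show "a = b" using R_injective \<open>R x y u v\<close> xy by blast
  qed
  show "theta ` strict_units = strict_units"
  proof
    show "theta ` strict_units \<subseteq> strict_units"
    proof
      fix b assume "b \<in> theta ` strict_units"
      then obtain x y where "b = theta (E x y)" "x < y" by (auto simp: strict_units_def)
      then show "b \<in> strict_units"
        using R_exists theta_E R_less(2) unfolding strict_units_def by blast
    qed
    show "strict_units \<subseteq> theta ` strict_units"
    proof
      fix b :: "('a, 'k) incidence"
      assume "b \<in> strict_units"
      then obtain u v where uv: "b = E u v" "u < v" by (auto simp: strict_units_def)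
      then obtain x y where "R x y u v" using R_surjective by blast
      then show "b \<in> theta ` strict_units"
        using uv theta_E R_less(1) unfolding strict_units_def by force
    qed
  qed
qed

section \<open>The scaling factors and their properties\<close>

lemma ratio_diff:
  assumes R: "R x y u v" and d: "d \<in> diagonal"
  shows "entry (\<phi> d) u u - entry (\<phi> d) v v = ratio x y * (entry d x x - entry d y y)"
proof -
  \<comment> \<open>Subtracting this multiple of \<open>E x x\<close> equalizes the entries at
    \<open>x\<close> and \<open>y\<close>, so \<open>phi_hyperplane\<close> applies; the subtracted
    term contributes \<open>ratio x y\<close> by definition.\<close>
  define d' where "d' = d - scale (entry d x x - entry d y y) (E x x)"
  have "x < y" using R by (rule R_less)
  then have "entry d' x x = entry d' y y"
    by (auto simp: d'_def entry_E)
  moreover have "d' \<in> diagonal"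
    by (simp add: d'_def d diagonal_diff diagonal_scale E_diagonal)
  ultimately have "entry (\<phi> d') u u = entry (\<phi> d') v v"
    using phi_hyperplane[OF \<open>x < y\<close>, of "\<phi> d'"] R by (simp add: phi_diagonal)
  then show ?thesis
    by (simp add: d'_def phi_linear ratio_eq[OF R] algebra_simps)
qed

lemma ratio_nonzero:
  assumes "x < y"
  shows "ratio x y \<noteq> 0"
proof
  assume "ratio x y = 0"
  moreover obtain u v where R: "R x y u v" using R_exists[OF assms] by blast
  ultimately have "entry (\<phi> (E x x)) u u = entry (\<phi> (E x x)) v v"
    by (simp add: ratio_eq)
  then have "\<forall>u v. R x y u v \<longrightarrow> entry (\<phi> (E x x)) u u = entry (\<phi> (E x x)) v v"
    using R R_unique by blast
  then show False
    using phi_hyperplane[OF assms, of "\<phi> (E x x)"] assms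
    by (auto simp: phi_diagonal E_diagonal entry_E split: if_splits)
qed

lemma nonzero_on_strict_ratio: "nonzero_on_strict ratio"
  by (simp add: nonzero_on_strict_def ratio_nonzero)

lemma nonzero_on_strict_sigma: "nonzero_on_strict sigma"
  unfolding nonzero_on_strict_def using R_exists sigma_eq by (metis R_def)

lemma compatible_ratio_sigma: "compatible ratio sigma theta"
  unfolding compatible_def
proof (intro allI impI)
  fix x y z :: 'a
  assume "x < y \<and> y < z"
  then have "x < y" "y < z" "x < z" by auto
  obtain a b p q r s where R: "R x y a b" "R y z p q" "R x z r s"
    using R_exists[OF \<open>x < y\<close>] R_exists[OF \<open>y < z\<close>] R_exists[OF \<open>x < z\<close>] by blast
  have less: "a < b" "p < q" "r < s" using R by (auto dest: R_less)
  \<comment> \<open>Hence an equation with a product on the right means that this product is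
    nonzero, which selects the alternative, and the sign, in \<open>R_triple\<close>.\<close>
  have "E r s \<noteq> (0 :: ('a, 'k) incidence)"
    using less by (simp add: E_nonzero)
  then show "(theta (E x z) = theta (E x y) * theta (E y z) \<longrightarrow>
        ratio x z * sigma x z = sigma x y * sigma y z) \<and>
      (theta (E x z) = theta (E y z) * theta (E x y) \<longrightarrow>
        ratio x z * sigma x z = - (sigma x y * sigma y z))"
    using R_triple(1)[OF R] less
    by (auto simp: theta_E[OF R(1)] theta_E[OF R(2)] theta_E[OF R(3)] E_mult less_imp_le
        sigma_eq[OF R(1)] sigma_eq[OF R(2)] sigma_eq[OF R(3)] ratio_eq[OF R(3)])
qed

text \<open>The image pair of \<open>(x, z)\<close> joins those of \<open>(x, y)\<close> and
  \<open>(y, z)\<close>. The image of \<open>E x x\<close> does not change across the second piece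
  and that of \<open>E z z\<close> does not change across the first, so each factor equals the one
  of the whole.\<close>

lemma ratio_triple:
  assumes "x < y" "y < z"
  shows "ratio x y = ratio x z" and "ratio y z = ratio x z"
proof -
  have "x < z" using assms by simp
  obtain a b p q r s where R: "R x y a b" "R y z p q" "R x z r s"
    using R_exists[OF assms(1)] R_exists[OF assms(2)] R_exists[OF \<open>x < z\<close>] by blast
  have "entry (\<phi> (E x x)) p p = entry (\<phi> (E x x)) q q"
    using ratio_diff[OF R(2) E_diagonal, of x] assms by (auto simp: entry_E split: if_splits)
  then show "ratio x y = ratio x z"
    using R_triple(1)[OF R] by (auto simp: ratio_eq[OF R(1)] ratio_eq[OF R(3)])
  have "entry (\<phi> (E z z)) a a = entry (\<phi> (E z z)) b b"
    using ratio_diff[OF R(1) E_diagonal, of z] assms by (auto simp: entry_E split: if_splits)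
  moreover have "entry (\<phi> (E z z)) p p - entry (\<phi> (E z z)) q q = - ratio y z"
    using ratio_diff[OF R(2) E_diagonal, of z] assms by (auto simp: entry_E split: if_splits)
  moreover have "entry (\<phi> (E z z)) r r - entry (\<phi> (E z z)) s s = - ratio x z"
    using ratio_diff[OF R(3) E_diagonal, of z] \<open>x < z\<close> by (auto simp: entry_E split: if_splits)
  moreover have "entry (\<phi> (E z z)) r r - entry (\<phi> (E z z)) s s
      = entry (\<phi> (E z z)) p p - entry (\<phi> (E z z)) q q"
    using R_triple(1)[OF R] calculation(1) by auto
  ultimately show "ratio y z = ratio x z" by simp
qed

lemma constant_on_maximal_chains_ratio: "constant_on_maximal_chains ratio"
  unfolding constant_on_maximal_chains_def
proof (intro allI impI)
  fix ys :: "'a list" and i j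
  assume "maximal_chain ys" and ij: "i < j \<and> j < length ys"
  then have sorted: "sorted_wrt (<) ys" by (simp add: maximal_chain_def)
  have less: "ys ! i < ys ! j"
    using sorted ij by (simp add: sorted_wrt_iff_nth_less)
  have "hd ys = ys ! 0" "last ys = ys ! (length ys - 1)"
    using ij by (simp_all add: hd_conv_nth last_conv_nth flip: length_greater_0_conv)
  moreover have "ys ! 0 < ys ! i" if "i \<noteq> 0"
    using sorted ij that by (simp add: sorted_wrt_iff_nth_less)
  moreover have "ys ! j < ys ! (length ys - 1)" if "j \<noteq> length ys - 1"
  proof -
    have "j < length ys - 1" using ij that by auto
    then show ?thesis using sorted by (simp add: sorted_wrt_iff_nth_less)
  qed
  ultimately have ends: "hd ys = ys ! i \<or> hd ys < ys ! i" "last ys = ys ! j \<or> ys ! j < last ys"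
    by metis+
  \<comment> \<open>The pair is enlarged at its upper end first, then at its lower end.\<close>
  have "ratio (ys ! i) (ys ! j) = ratio (ys ! i) (last ys)"
    using ends(2) ratio_triple(1)[OF less] by auto
  moreover have "ys ! i < last ys"
    using ends(2) less by auto
  ultimately show "ratio (ys ! i) (ys ! j) = ratio (hd ys) (last ys)"
    using ends(1) ratio_triple(2) by auto
qed

lemma monotone_on_maximal_chains_theta: "monotone_on_maximal_chains theta"
  unfolding monotone_on_maximal_chains_def
proof (intro allI impI)
  fix us :: "'a list"
  assume us: "maximal_chain us"
  then have sorted: "\<And>i j. i < j \<Longrightarrow> j < length us \<Longrightarrow> us ! i < us ! j"
    and max: "pred_on.maxchain UNIV (<) (set us)"
    by (auto simp: maximal_chain_def sorted_wrt_iff_nth_less)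
  then have chain: "pred_on.chain UNIV (<) (set us)"
    by (simp add: pred_on.maxchain_def)
  show "increasing_on_chain theta us \<or> decreasing_on_chain theta us"
  proof (cases "length us \<le> 1")
    case True
    \<comment> \<open>There is no strict pair to check, so the chain itself serves as
      witness.\<close>
    then have "increasing_on_chain theta us"
      unfolding increasing_on_chain_def using us by (intro exI[of _ us]) auto
    then show ?thesis ..
  next
    case False
    then have two: "us ! 0 \<in> set us" "us ! 1 \<in> set us" "us ! 0 \<noteq> us ! 1"
      using sorted[of 0 1] by (auto simp: not_le intro: nth_mem)
    obtain p where p: "(\<forall>x\<in>set us. \<forall>y\<in>set us. x < y \<longrightarrow> R x y (p x) (p y)) \<or>
        (\<forall>x\<in>set us. \<forall>y\<in>set us. x < y \<longrightarrow> R x y (p y) (p x))"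
      using chain_image[OF chain] by blast
    note max' = maxchain_image[OF max two p]
    from p show ?thesis
    proof
      assume "\<forall>x\<in>set us. \<forall>y\<in>set us. x < y \<longrightarrow> R x y (p x) (p y)"
      then have R: "R (us ! i) (us ! j) (p (us ! i)) (p (us ! j))" if "i < j" "j < length us" for i j
        using sorted that by simp
      then have "maximal_chain (map p us)"
        using max' by (auto simp: maximal_chain_def sorted_wrt_iff_nth_less dest: R_less)
      then have "increasing_on_chain theta us"
        unfolding increasing_on_chain_def using R by (intro exI[of _ "map p us"]) (auto simp: theta_E)
      then show ?thesis ..
    next
      assume "\<forall>x\<in>set us. \<forall>y\<in>set us. x < y \<longrightarrow> R x y (p y) (p x)"
      then have R: "R (us ! i) (us ! j) (p (us ! j)) (p (us ! i))" if "i < j" "j < length us" for i j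
        using sorted that by simp
      have "rev (map p us) ! i < rev (map p us) ! j" if "i < j" "j < length us" for i j
        using R_less(2)[OF R[of "length us - Suc j" "length us - Suc i"]] that by (simp add: rev_nth)
      then have "maximal_chain (rev (map p us))"
        using max' by (simp add: maximal_chain_def sorted_wrt_iff_nth_less)
      then have "decreasing_on_chain theta us"
        unfolding decreasing_on_chain_def using R
        by (intro exI[of _ "rev (map p us)"]) (auto simp: theta_E rev_nth)
      then show ?thesis ..
    qed
  qed
qed

section \<open>Sums along walks\<close>

lemma step_delta_ratio:
  assumes "v < w" and "u < u' \<Longrightarrow> R v w u u'" and "u' < u \<Longrightarrow> R v w u' u"
    and "u \<le> u' \<or> u' \<le> u"
  shows "entry (\<phi> (E z z)) u' u' - entry (\<phi> (E z z)) u u = step_delta ratio u u' v w z"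
proof -
  consider "u < u'" | "u' < u" | "u = u'" using assms(4) by force
  then show ?thesis
  proof cases
    \<comment> \<open>The entries of \<open>E z z\<close> at \<open>v\<close> and \<open>w\<close>
      differ by 1, -1 or 0, which gives the three branches of \<open>step_delta\<close>; a downward
      step reverses the sign.\<close>
    case 1
    then show ?thesis
      using ratio_diff[OF assms(2)[OF 1] E_diagonal, of z] \<open>v < w\<close>
      by (auto simp: step_delta_def entry_E algebra_simps)
  next
    case 2
    then show ?thesis
      using ratio_diff[OF assms(3)[OF 2] E_diagonal, of z] \<open>v < w\<close>
      by (auto simp: step_delta_def entry_E algebra_simps)
  qed (simp add: step_delta_def)
qed

lemma admissible_pair_theta_ratio: "admissible_pair theta ratio"
  unfolding admissible_pair_def
proof (intro allI impI)
  fix us :: "'a list" and z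
  assume closed: "closed_walk us"
  define F where "F u = entry (\<phi> (E z z)) u u" for u
  define Out where "Out u u' = (\<Sum>w | z < w \<and> theta (E z w) = E u u'. ratio z w)" for u u'
  define In where "In u u' = (\<Sum>w | w < z \<and> theta (E w z) = E u u'. ratio w z)" for u u'
  \<comment> \<open>Injectivity of \<open>R\<close> leaves at most one summand in \<open>Out\<close>
    and \<open>In\<close>, and \<open>ratio_diff\<close> for \<open>E z z\<close> identifies their
    difference.\<close>
  have diff: "F u - F u' = Out u u' - In u u'" if uu': "u < u'" for u u'
  proof -
    obtain v w where R: "R v w u u'" using R_surjective[OF uu'] by blast
    have theta_iff: "x < y \<and> theta (E x y) = E u u' \<longleftrightarrow> x = v \<and> y = w" for x y
    proof -
      have "x < y \<and> theta (E x y) = E u u' \<longleftrightarrow> R x y u u'"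
        using theta_E_iff[of x y u u'] uu' R_less(1)[of x y u u'] by blast
      then show ?thesis using R R_injective[OF R, of x y] by blast
    qed
    have "Out u u' = (if z = v then ratio v w else 0)"
      "In u u' = (if z = w then ratio v w else 0)"
      by (simp_all add: Out_def In_def theta_iff)
    then show ?thesis
      using ratio_diff[OF R E_diagonal, of z] R_less(1)[OF R] by (auto simp: F_def entry_E)
  qed
  define up where "up = {i. i < length us - 1 \<and> us ! i < us ! (i + 1)}"
  define down where "down = {i. i < length us - 1 \<and> us ! i > us ! (i + 1)}"
  have "walk us" and "hd us = last us" using closed by (auto simp: closed_walk_def)
  have "(\<Sum>i<length us - 1. F (us ! i) - F (us ! (i + 1)))
      = (\<Sum>i\<in>up \<union> down. F (us ! i) - F (us ! (i + 1)))"
  proof (rule sum.mono_neutral_right)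
    show "\<forall>i\<in>{..<length us - 1} - (up \<union> down). F (us ! i) - F (us ! (i + 1)) = 0"
    proof
      fix i assume "i \<in> {..<length us - 1} - (up \<union> down)"
      then have "us ! i = us ! (i + 1)"
        using walk_comparable[OF \<open>walk us\<close>, of i] by (auto simp: up_def down_def less_le)
      then show "F (us ! i) - F (us ! (i + 1)) = 0" by simp
    qed
  qed (auto simp: up_def down_def)
  also have "\<dots> = (\<Sum>i\<in>up. F (us ! i) - F (us ! (i + 1))) + (\<Sum>i\<in>down. F (us ! i) - F (us ! (i + 1)))"
    by (rule sum.union_disjoint) (auto simp: up_def down_def)
  also have "(\<Sum>i\<in>up. F (us ! i) - F (us ! (i + 1))) =
      (\<Sum>i\<in>up. Out (us ! i) (us ! (i + 1)) - In (us ! i) (us ! (i + 1)))"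
    by (rule sum.cong) (simp_all add: up_def diff)
  also have "\<dots> = s_plus theta ratio us z - t_plus theta ratio us z"
    by (simp only: s_plus_def t_plus_def up_def Out_def In_def sum_subtractf)
  also have "(\<Sum>i\<in>down. F (us ! i) - F (us ! (i + 1))) =
      (\<Sum>i\<in>down. In (us ! (i + 1)) (us ! i) - Out (us ! (i + 1)) (us ! i))"
  proof (rule sum.cong)
    fix i assume "i \<in> down"
    then have "F (us ! (i + 1)) - F (us ! i) = Out (us ! (i + 1)) (us ! i) - In (us ! (i + 1)) (us ! i)"
      by (intro diff) (simp add: down_def)
    then show "F (us ! i) - F (us ! (i + 1)) = In (us ! (i + 1)) (us ! i) - Out (us ! (i + 1)) (us ! i)"
      by (metis minus_diff_eq)
  qed simp
  also have "\<dots> = t_minus theta ratio us z - s_minus theta ratio us z"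
    by (simp only: s_minus_def t_minus_def down_def Out_def In_def sum_subtractf)
  finally have "(\<Sum>i<length us - 1. F (us ! i) - F (us ! (i + 1))) =
      s_plus theta ratio us z - t_plus theta ratio us z
        + (t_minus theta ratio us z - s_minus theta ratio us z)" .
  moreover have "(\<Sum>i<length us - 1. F (us ! i) - F (us ! (i + 1))) =
      - (\<Sum>i<length us - 1. F (us ! (i + 1)) - F (us ! i))"
    by (simp only: sum_negf[symmetric] minus_diff_eq)
  ultimately have "s_plus theta ratio us z - t_plus theta ratio us z
      + (t_minus theta ratio us z - s_minus theta ratio us z) = 0"
    using walk_telescope[OF \<open>walk us\<close>, of F] \<open>hd us = last us\<close> by simp
  then show "s_plus theta ratio us z - s_minus theta ratio us z =
      t_plus theta ratio us z - t_minus theta ratio us z"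
    by (simp add: algebra_simps)
qed

text \<open>This \<open>alpha\<close> vanishes on diagonal elements and sends \<open>\<phi> (E x y)\<close>, for \<open>x < y\<close>, to its diagonal
  part.\<close>

definition alpha :: "('a, 'k) incidence \<Rightarrow> ('a, 'k) incidence"
  where "alpha f = diagonal_part (\<phi> (\<psi> f - diagonal_part (\<psi> f)))"

definition tau :: "('a, 'k) incidence \<Rightarrow> ('a, 'k) incidence"
  where "tau f = \<phi> f - alpha (\<phi> f)"

section \<open>The shift and the pure factor\<close>

lemma alpha_diagonal: "alpha f \<in> diagonal"
  by (simp add: alpha_def diagonal_part_diagonal)

lemma alpha_linear:
  "alpha (f + g) = alpha f + alpha g" "alpha (f - g) = alpha f - alpha g"
  "alpha (scale k f) = scale k (alpha f)"
proof -
  interpret inverse: comm_diag_preserver \<psi> by (rule inverse_preserver)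
  show "alpha (f + g) = alpha f + alpha g" "alpha (f - g) = alpha f - alpha g"
    by (simp_all add: alpha_def inverse.phi_linear phi_linear diagonal_part_linear)
  show "alpha (scale k f) = scale k (alpha f)"
    by (simp add: alpha_def inverse.phi_linear phi_linear diagonal_part_linear
        incidence.scale_right_diff_distrib)
qed

lemma inc_linear_alpha: "inc_linear alpha"
  by (simp add: inc_linear_iff alpha_linear)

lemma inc_linear_tau: "inc_linear tau"
  by (simp add: inc_linear_iff tau_def phi_linear alpha_linear incidence.scale_right_diff_distrib)

lemma alpha_of_diagonal: "d \<in> diagonal \<Longrightarrow> alpha d = 0"
  using phi_linear(2)[of 0 0] by (simp add: alpha_def diagonal_part_id psi_diagonal
      diagonal_part_linear(2)[of 0 0, simplified])

lemma alpha_phi_E: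
  assumes "x < y"
  shows "alpha (\<phi> (E x y)) = diagonal_part (\<phi> (E x y))"
proof -
  have "diagonal_part (E x y) = (0 :: ('a, 'k) incidence)"
    using assms by (intro incidence_eqI) (auto simp: entry_E)
  then show ?thesis by (simp add: alpha_def)
qed

text \<open>Apply \<open>alpha\<close> to the normal form \<open>phi_E\<close>, whose diagonal
  summand it kills. This transfers \<open>phi_E_diagonal_entries\<close> to
  \<open>alpha\<close>.\<close>

lemma alpha_E:
  assumes R: "R x y u v"
  shows "scale (entry (\<phi> (E x y)) u v) (alpha (E u v)) = diagonal_part (\<phi> (E x y))"
proof -
  have "alpha (\<phi> (E x y)) = scale (entry (\<phi> (E x y)) u v) (alpha (E u v))
      + alpha (diagonal_part (\<phi> (E x y)))"
    by (subst phi_E[OF R]) (simp only: alpha_linear)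
  then show ?thesis
    by (simp add: alpha_phi_E[OF R_less(1)[OF R]] alpha_of_diagonal diagonal_part_diagonal)
qed

lemma alpha_E_entries:
  assumes "u < v" "r < s" "\<not> (r = u \<and> s = v)"
  shows "entry (alpha (E u v)) r r = entry (alpha (E u v)) s s"
proof -
  obtain x y where R: "R x y u v" using R_surjective[OF assms(1)] by blast
  have "entry (\<phi> (E x y)) u v * entry (alpha (E u v)) w w = entry (\<phi> (E x y)) w w" for w
    using arg_cong[OF alpha_E[OF R], of "\<lambda>f. entry f w w"] by simp
  then have "entry (\<phi> (E x y)) u v * entry (alpha (E u v)) r r
      = entry (\<phi> (E x y)) u v * entry (alpha (E u v)) s s"
    using phi_E_diagonal_entries[OF R assms(2,3)] by simp
  then show ?thesis using R by (simp add: R_def)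
qed

text \<open>The left side is a functional of \<open>f\<close> that vanishes on every unit other than
  \<open>E u v\<close>; expanding \<open>f\<close> in units gives the hypothesis of
  \<open>commutator_shift\<close>.\<close>

lemma alpha_entries:
  assumes "u < v"
  shows "entry (alpha f) u u - entry (alpha f) v v =
    entry f u v * (entry (alpha (E u v)) u u - entry (alpha (E u v)) v v)"
proof -
  define F where "F f = entry (alpha f) u u - entry (alpha f) v v" for f
  have F_linear: "F (f + g) = F f + F g" "F (scale k f) = k * F f" for f g k
    by (simp_all add: F_def alpha_linear algebra_simps)
  have F0: "F 0 = 0" using F_linear(2)[of 0 0] by simp
  have F_sum: "F (sum h A) = (\<Sum>a\<in>A. F (h a))" for h and A :: "('a \<times> 'a) set"
    by (induction A rule: infinite_finite_induct) (simp_all add: F0 F_linear)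
  have F_E: "F (E x y) = 0" if "\<not> (x = u \<and> y = v)" for x y
  proof -
    consider "x < y" | "x = y" | "\<not> x \<le> y" by (auto simp: le_less)
    then show ?thesis
    proof cases
      case 1
      then show ?thesis using alpha_E_entries[OF 1 assms] that by (auto simp: F_def)
    next
      case 2
      then show ?thesis by (simp add: F_def alpha_of_diagonal E_diagonal)
    next
      case 3
      then have "E x y = (0 :: ('a, 'k) incidence)"
        by (intro incidence_eqI) (simp add: entry_E)
      then show ?thesis by (simp add: F0)
    qed
  qed
  have "F f = (\<Sum>p\<in>UNIV. entry f (fst p) (snd p) * F (E (fst p) (snd p)))"
    by (subst incidence_expand) (simp add: F_sum F_linear)
  also have "\<dots> = (\<Sum>p\<in>UNIV. if p = (u, v) then entry f u v * F (E u v) else 0)"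
  proof (rule sum.cong)
    fix p :: "'a \<times> 'a"
    show "entry f (fst p) (snd p) * F (E (fst p) (snd p)) =
        (if p = (u, v) then entry f u v * F (E u v) else 0)"
      using F_E[of "fst p" "snd p"] by (auto simp: prod_eq_iff)
  qed simp
  finally show ?thesis by (simp add: F_def)
qed

lemma commutator_shift_alpha: "commutator (shift alpha f) (shift alpha g) = commutator f g"
  using alpha_diagonal by (intro commutator_shift[OF _ alpha_entries]) auto

text \<open>\<open>tau\<close> is the shift by \<open>- alpha\<close> after \<open>\<phi>\<close>,
  and \<open>- alpha\<close> satisfies the same locality condition with the opposite factor.\<close>

lemma commutator_tau: "commutator (tau f) (tau g) = commutator (\<phi> f) (\<phi> g)"
proof -
  have "commutator (shift (\<lambda>f. - alpha f) (\<phi> f)) (shift (\<lambda>f. - alpha f) (\<phi> g))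
      = commutator (\<phi> f) (\<phi> g)"
  proof (rule commutator_shift)
    show "range (\<lambda>f. - alpha f) \<subseteq> diagonal"
      using alpha_diagonal by (auto simp: diagonal_iff)
    show "entry (- alpha f) u u - entry (- alpha f) v v =
        entry f u v * (entry (alpha (E u v)) v v - entry (alpha (E u v)) u u)" if "u < v" for f u v
      using alpha_entries[OF that, of f] by (simp add: algebra_simps)
  qed
  then show ?thesis by (simp add: shift_def tau_def)
qed

lemma shift_type_alpha: "shift_type alpha"
proof -
  have "inc_linear (shift alpha)"
    by (simp add: inc_linear_iff shift_def alpha_linear incidence.scale_right_distrib)
  then have "strong_commutativity_preserver (shift alpha)"
    by (simp add: strong_commutativity_preserver_def commutativity_preserver_def
        commutator_shift_alpha)
  moreover have "commutator (alpha a) b = 0"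
    if "a \<in> strict_units" "b \<in> strict_units" "a \<noteq> b" for a b
  proof -
    obtain u v r s where uv: "a = E u v" "u < v" and rs: "b = E r s" "r < s"
      using \<open>a \<in> strict_units\<close> \<open>b \<in> strict_units\<close> by (auto simp: strict_units_def)
    then have "\<not> (r = u \<and> s = v)" using \<open>a \<noteq> b\<close> by blast
    then show ?thesis
      using uv rs by (simp add: commutator_diagonal_E_iff alpha_diagonal alpha_E_entries)
  qed
  moreover have "commutator (alpha (E z z)) f = 0" "commutator f (alpha (E z z)) = 0" for z f
    by (simp_all add: alpha_of_diagonal E_diagonal commutator_def)
  moreover have "- E x y \<noteq> (0 :: ('a, 'k) incidence)" if "x < y" for x y
    using that E_nonzero[of x y, where 'b = 'k] by simp
  ultimately show ?thesis
    using alpha_diagonal unfolding shift_type_def by (auto simp: inc_linear_alpha)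
qed

text \<open>\<open>alpha\<close> has diagonal values and vanishes on them, so
  \<open>alpha \<circ> alpha\<close> is zero, and adding and subtracting \<open>alpha\<close> are
  mutually inverse.\<close>

lemma shift_alpha_tau: "\<phi> = shift alpha \<circ> tau"
  by (rule ext) (simp add: shift_def tau_def alpha_linear alpha_of_diagonal alpha_diagonal)

lemma tau_of_diagonal: "d \<in> diagonal \<Longrightarrow> tau d = \<phi> d"
  by (simp add: tau_def alpha_of_diagonal phi_diagonal)

lemma tau_E:
  assumes "x < y"
  shows "tau (E x y) = scale (sigma x y) (theta (E x y))"
proof -
  obtain u v where R: "R x y u v" using R_exists[OF assms] by blast
  have "\<phi> (E x y) - diagonal_part (\<phi> (E x y)) = scale (entry (\<phi> (E x y)) u v) (E u v)"
    using phi_E[OF R] by (metis add_diff_cancel_right')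
  then show ?thesis
    by (simp add: tau_def alpha_phi_E[OF assms] theta_E[OF R] sigma_eq[OF R])
qed

lemma bij_tau: "bij tau"
proof -
  have "bij (\<lambda>f. f - alpha f)"
    by (rule o_bij[of "shift alpha"])
      (auto simp: fun_eq_iff shift_def alpha_linear alpha_of_diagonal alpha_diagonal)
  then have "bij ((\<lambda>f. f - alpha f) \<circ> \<phi>)"
    using bij bij_comp by blast
  then show ?thesis by (simp add: tau_def[abs_def] comp_def)
qed

lemma pure_tau: "pure_commutativity_preserver tau"
proof -
  have "strong_commutativity_preserver tau"
    unfolding strong_commutativity_preserver_def commutativity_preserver_def
    by (simp add: inc_linear_tau commutator_tau commutator_phi_iff)
  moreover have "diagonality_preserver tau"
    using inc_linear_tau phi_diagonal by (auto simp: diagonality_preserver_def tau_of_diagonal)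
  moreover have "preserver_data tau theta sigma (\<lambda>_. 0)"
    using bij_betw_theta nonzero_on_strict_sigma tau_E
    by (auto simp: preserver_data_def diagonal_iff)
  ultimately show ?thesis
    unfolding pure_commutativity_preserver_def using bij_tau by blast
qed

text \<open>By \<open>step_delta_ratio\<close> each summand is the difference of two consecutive
  diagonal entries, so the sum telescopes; \<open>\<kappa>\<close> is read off at
  \<open>x 1\<close>.\<close>

lemma is_tau_tau:
  fixes x :: "nat \<Rightarrow> 'a" and n :: nat
  shows "is_tau x n theta sigma ratio (\<lambda>i. entry (\<phi> (E (x i) (x i))) (x 1) (x 1)) tau"
  unfolding is_tau_def
proof (intro conjI allI impI ballI inc_linear_tau)
  fix a b :: 'a
  assume "a < b"
  then show "tau (E a b) = scale (sigma a b) (theta (E a b))" by (rule tau_E)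
next
  fix z :: 'a
  show "tau (E z z) \<in> diagonal" by (simp add: tau_of_diagonal phi_diagonal E_diagonal)
next
  fix i
  show "entry (tau (E (x i) (x i))) (x 1) (x 1) = entry (\<phi> (E (x i) (x i))) (x 1) (x 1)"
    by (simp add: tau_of_diagonal E_diagonal)
next
  fix us :: "'a list" and vs ws z
  assume asm: "walk us \<and> hd us = x 1 \<and>
    (\<forall>i < length us - 1. vs i < ws i \<and>
      (us ! i < us ! (i + 1) \<longrightarrow> theta (E (vs i) (ws i)) = E (us ! i) (us ! (i + 1))) \<and>
      (us ! i > us ! (i + 1) \<longrightarrow> theta (E (vs i) (ws i)) = E (us ! (i + 1)) (us ! i)))"
  have step: "entry (\<phi> (E z z)) (us ! (i + 1)) (us ! (i + 1)) - entry (\<phi> (E z z)) (us ! i) (us ! i)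
      = step_delta ratio (us ! i) (us ! (i + 1)) (vs i) (ws i) z" if "i < length us - 1" for i
    using asm that walk_comparable[of us i] theta_E_iff by (intro step_delta_ratio) blast+
  have "(\<Sum>i<length us - 1. step_delta ratio (us ! i) (us ! (i + 1)) (vs i) (ws i) z) =
      (\<Sum>i<length us - 1. entry (\<phi> (E z z)) (us ! (i + 1)) (us ! (i + 1))
        - entry (\<phi> (E z z)) (us ! i) (us ! i))"
    by (rule sum.cong) (simp_all add: step del: One_nat_def)
  also have "\<dots> = entry (\<phi> (E z z)) (last us) (last us) - entry (\<phi> (E z z)) (x 1) (x 1)"
    using walk_telescope[of us "\<lambda>u. entry (\<phi> (E z z)) u u"] asm by simp
  finally have "entry (\<phi> (E z z)) (last us) (last us) - entry (\<phi> (E z z)) (x 1) (x 1) =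
      (\<Sum>i<length us - 1. step_delta ratio (us ! i) (us ! (i + 1)) (vs i) (ws i) z)"
    by (rule sym)
  then show "entry (tau (E z z)) (last us) (last us) = entry (tau (E z z)) (x 1) (x 1) +
      (\<Sum>i<length us - 1. step_delta ratio (us ! i) (us ! (i + 1)) (vs i) (ws i) z)"
    by (simp add: tau_of_diagonal E_diagonal algebra_simps)
qed

section \<open>The image of the identity and the sum of \<open>\<kappa>\<close>\<close>

lemma entry_phi_one_nonzero:
  assumes "connected_poset TYPE('a)"
  shows "entry (\<phi> 1) w w \<noteq> 0"
proof
  assume zero: "entry (\<phi> 1) w w = 0"
  \<comment> \<open>The diagonal entries of \<open>1\<close> are all equal, so
    \<open>ratio_diff\<close> makes those of \<open>\<phi> 1\<close> agree at comparable elements;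
    connectedness then spreads a zero everywhere, against injectivity.\<close>
  have step: "entry (\<phi> 1) u u = entry (\<phi> 1) v v" if "u \<le> v" for u v
  proof (cases "u = v")
    case False
    then have "u < v" using that by simp
    then obtain x y where R: "R x y u v" using R_surjective by blast
    show ?thesis using ratio_diff[OF R one_diagonal] by (simp add: entry_one)
  qed simp
  have "entry (\<phi> 1) v v = 0" for v
  proof -
    obtain us where us: "walk us" "hd us = w" "last us = v"
      using assms by (auto simp: connected_poset_def)
    have "(\<Sum>i<length us - 1. entry (\<phi> 1) (us ! (i + 1)) (us ! (i + 1))
        - entry (\<phi> 1) (us ! i) (us ! i)) = 0"
      using walk_comparable[OF us(1)] step by (intro sum.neutral) force
    then show ?thesis
      using walk_telescope[OF us(1), of "\<lambda>u. entry (\<phi> 1) u u"] us zero by simp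
  qed
  then have "\<phi> 1 = 0"
    using phi_diagonal[OF one_diagonal] by (intro incidence_eqI) (metis diagonal_iff entry_zero)
  moreover have "\<phi> 0 = 0" using phi_linear(2)[of 0 0] by simp
  ultimately show False using psi_phi zero_neq_one by metis
qed

lemma phi_sum: "\<phi> (sum h A) = (\<Sum>a\<in>A. \<phi> (h a))"
  using phi_linear(2)[of 0 0]
  by (induction A rule: infinite_finite_induct) (simp_all add: phi_linear)

text \<open>The units \<open>E z z\<close> add up to \<open>1\<close>, so the sum is a diagonal
  entry of \<open>\<phi> 1\<close>.\<close>

lemma sum_kappa_nonzero:
  fixes x :: "nat \<Rightarrow> 'a" and n :: nat
  assumes "connected_poset TYPE('a)" "bij_betw x {1..n} UNIV"
  shows "(\<Sum>i=1..n. entry (\<phi> (E (x i) (x i))) w w) \<noteq> 0"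
proof -
  have "(1 :: ('a, 'k) incidence) = (\<Sum>z\<in>UNIV. E z z)"
  proof (rule incidence_eqI)
    fix u v :: 'a
    have "(\<Sum>z\<in>UNIV. entry (E z z) u v) = (\<Sum>z\<in>UNIV. if z = u then if u = v then 1 else 0 else (0 :: 'k))"
      by (rule sum.cong) (auto simp: entry_E)
    then show "entry (1 :: ('a, 'k) incidence) u v = entry (\<Sum>z\<in>UNIV. E z z) u v"
      by (simp add: entry_one entry_sum)
  qed
  also have "\<dots> = (\<Sum>i=1..n. E (x i) (x i))"
    by (rule sum.reindex_bij_betw[OF assms(2), symmetric])
  finally have "\<phi> 1 = \<phi> (\<Sum>i=1..n. E (x i) (x i))"
    by (rule arg_cong)
  then have "entry (\<phi> 1) w w = (\<Sum>i=1..n. entry (\<phi> (E (x i) (x i))) w w)"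
    by (simp only: phi_sum entry_sum)
  then show ?thesis using entry_phi_one_nonzero[OF assms(1), of w] by simp
qed

end

theorem corollary3p36:
  fixes x :: "nat \<Rightarrow> 'a::{finite,order}"
    and n :: nat
    and \<phi> :: "('a, 'k::field) incidence \<Rightarrow> ('a, 'k) incidence"
  assumes "n > 1"
    and "bij_betw x {1..n} UNIV"
    and "connected_poset TYPE('a)"
    and "bij \<phi>"
    and "strong_commutativity_preserver \<phi>"
    and "diagonality_preserver \<phi>"
  shows "\<exists>\<alpha> \<theta> \<sigma> c \<kappa> \<tau>.
    shift_type \<alpha> \<and>
    bij_betw \<theta> (strict_units :: ('a, 'k) incidence set) strict_units \<and>
    monotone_on_maximal_chains \<theta> \<and>
    nonzero_on_strict \<sigma> \<and> compatible c \<sigma> \<theta> \<and>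
    nonzero_on_strict c \<and> constant_on_maximal_chains c \<and>
    admissible_pair \<theta> c \<and>
    (\<Sum>i=1..n. \<kappa> i) \<noteq> 0 \<and>
    is_tau x n \<theta> \<sigma> c \<kappa> \<tau> \<and>
    pure_commutativity_preserver \<tau> \<and>
    \<phi> = shift \<alpha> \<circ> \<tau>"
proof -
  interpret comm_diag_preserver \<phi>
    using assms(4-6) by unfold_locales
  show ?thesis
    using shift_type_alpha bij_betw_theta monotone_on_maximal_chains_theta nonzero_on_strict_sigma
      compatible_ratio_sigma nonzero_on_strict_ratio constant_on_maximal_chains_ratio
      admissible_pair_theta_ratio sum_kappa_nonzero[OF assms(3,2), of "x 1"] is_tau_tau[of x n]
      pure_tau shift_alpha_tau
    by blast
qed

end
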